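(* Let $K$ be a field of characteristic zero. Let $\mathcal R:\mathbf{HopfDialg}\to\mathbf{Rack}$ be the functor assigning to a cocommutative Hopf dialgebra $A$ over $K$ the rack of set-like elements of its adjoint rack bialgebra, $\mathcal R(A):=\mathrm{Slike}(\mathrm{Adj}(A))$, and to a morphism its restriction to set-like elements. Then there is a natural isomorphism of functors $$\mathcal R\cong \mathrm{Conj}\circ \mathrm{Glike}.$$ Equivalently, $\mathcal R$ factorizes (up to natural isomorphism) as $$\mathbf{HopfDialg}\xrightarrow{\ \mathrm{Glike}\ }\mathbf{Dig}\hookrightarrow\mathbf{gDig}\xrightarrow{\ \mathrm{Conj}\ }\mathbf{Rack}.$$ More explicitly, for every cocommutative Hopf dialgebra $A=(A,\Delta,\varepsilon,\xi,\vdash,\dashv,S)$ and all $g,h\in \mathrm{Glike}(A)$, the rack product induced by the adjoint construction satisfies $$g\triangleright h=\sum_{(g)}(g_{(1)}\vdash h)\dashv S(g_{(2)})=(g\vdash h)\dashv S(g),$$ and this is precisely the conjugation rack operation of the digroup $\mathrm{Glike}(A)$.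
   Context: Tensor products are over $K$; Sweedler notation $\Delta(a)=\sum_{(a)}a_{(1)}\otimes a_{(2)}$ is used. A cocommutative Hopf dialgebra $(A,\Delta,\varepsilon,\xi,\vdash,\dashv,S)$ consists of a cocommutative $K$-coalgebra $(A,\Delta,\varepsilon)$, two associative bilinear products $\vdash,\dashv:A\otimes A\to A$, an element $\xi\in A$ and a coalgebra morphism $S:A\to A$ such that for all $a,b,c\in A$: (1) $(a\vdash b)\vdash c=(a\dashv b)\vdash c$, $a\dashv(b\dashv c)=a\dashv(b\vdash c)$, $(a\vdash b)\dashv c=a\vdash(b\dashv c)$; (2) $\xi\vdash a=a=a\dashv\xi$ and $a\vdash\xi=\xi\dashv a$; (3) $\Delta(\xi)=\xi\otimes\xi$, $\varepsilon(\xi)=1$; (4) each $\star\in\{\vdash,\dashv\}$ is a coalgebra morphism: $\Delta(a\star b)=\sum (a_{(1)}\star b_{(1)})\otimes(a_{(2)}\star b_{(2)})$ and $\varepsilon(a\star b)=\varepsilon(a)\varepsilon(b)$; (5) $\sum_{(a)}a_{(1)}\vdash S(a_{(2)})=\varepsilon(a)\xi=\sum_{(a)}S(a_{(1)})\dashv a_{(2)}$. $\mathbf{HopfDialg}$ is the category of these, with morphisms the coalgebra morphisms preserving $\xi$, both products and $S$. $\mathrm{Glike}(A)=\{g\in A\mid\Delta(g)=g\otimes g,\ \varepsilon(g)=1\}$. A rack is a nonempty set $X$ with a binary operation $\triangleright$ such that every left translation $L_x(y)=x\triangleright y$ is bijective and $x\triangleright(y\triangleright z)=(x\triangleright y)\triangleright(x\triangleright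 z)$; $\mathbf{Rack}$ is the category of racks and maps preserving $\triangleright$. A cocommutative rack bialgebra $(B,\Delta,\varepsilon,\xi,\triangleright)$ is a cocommutative coalgebra with a group-like element $\xi$ and a coalgebra morphism $\triangleright:B\otimes B\to B$ with $\xi\triangleright a=a$, $a\triangleright\xi=\varepsilon(a)\xi$ and $a\triangleright(b\triangleright c)=\sum_{(a)}(a_{(1)}\triangleright b)\triangleright(a_{(2)}\triangleright c)$. For a cocommutative Hopf dialgebra $A$, it is known that $\mathrm{Adj}(A):=(A,\Delta,\varepsilon,\xi,\triangleright)$ with $a\triangleright b:=\sum_{(a)}(a_{(1)}\vdash b)\dashv S(a_{(2)})$ is a cocommutative rack bialgebra. For a rack bialgebra $B$, $\mathrm{Slike}(B):=\{b\in B\mid\Delta(b)=b\otimes b,\ \varepsilon(b)=1\}$, with the restricted product $\triangleright$; for $B=\mathrm{Adj}(A)$ this is a rack. A generalized digroup is a nonempty set $D$ with two associative binary operations $\vdash,\dashv$ satisfying $x\vdash(y\dashv z)=(x\vdash y)\dashv z$, $x\dashv(y\dashv z)=x\dashv(y\vdash z)$, $(x\vdash y)\vdash z=(x\dashv y)\vdash z$, such that there is at least one bar-unit (an element $\xi$ with $x\dashv\xi=x=\xi\vdash x$ for all $x$), and for every bar-unit $\xi$ and every $x\in D$ there are $x^{-1}_{r,\xi},x^{-1}_{l,\xi}\in D$ with $x\vdash x^{-1}_{r,\xi}=\xi$ and $x^{-1}_{l,\xi}\dashv x=\xi$. $\mathrm{Halo}(D)$ is the set of bar-units. $\mathbf{gDig}$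 has generalized digroups as objects and as morphisms the maps preserving both products and sending bar-units to bar-units. A digroup is a generalized digroup with a distinguished bar-unit $\xi$ such that every $x$ admits a single inverse $x^{-1}$ with $x\vdash x^{-1}=\xi=x^{-1}\dashv x$. $\mathbf{Dig}$ is the category of digroups, with morphisms the $\mathbf{gDig}$-morphisms preserving the distinguished bar-unit. For a generalized digroup $D$, the conjugation rack $\mathrm{Conj}(D)$ is the set $D$ with $x\triangleright y:=(x\vdash y)\dashv x^{-1}$, where $x^{-1}$ is any one-sided inverse of $x$ (right for $\vdash$ or left for $\dashv$) relative to a bar-unit; this does not depend on the choice, is a rack, and gives a functor $\mathrm{Conj}:\mathbf{gDig}\to\mathbf{Rack}$ that is the identity on underlying maps. The functor $\mathrm{Glike}:\mathbf{HopfDialg}\to\mathbf{Dig}$ sends $A$ to $\mathrm{Glike}(A)$ with the restricted products, distinguished bar-unit $\xi$ and inverse $g^{-1}=S(g)$, and a morphism to its restriction. *)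

theory Defs
  imports "HOL-Algebra.Module" "HOL-Algebra.AbelCoset"
begin

section \<open>Categories, functors and natural isomorphisms\<close>

text \<open>
  Arrows are indexed by their end points: \<open>Hom C X Y\<close> is the set of arrows from \<open>X\<close> to \<open>Y\<close>, and
  \<open>Comp C X Y Z g f\<close> is the composite of \<open>f \<in> Hom C X Y\<close> and \<open>g \<in> Hom C Y Z\<close>.
\<close>

record ('o, 'm) cat =
  Obj :: "'o set"
  Hom :: "'o \<Rightarrow> 'o \<Rightarrow> 'm set"
  Ident :: "'o \<Rightarrow> 'm"
  Comp :: "'o \<Rightarrow> 'o \<Rightarrow> 'o \<Rightarrow> 'm \<Rightarrow> 'm \<Rightarrow> 'm"

locale category =
  fixes C :: "('o, 'm) cat"
  assumes Ident_in_Hom: "X \<in> Obj C \<Longrightarrow> Ident C X \<in> Hom C X X"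
    and Comp_in_Hom:
      "\<lbrakk>X \<in> Obj C; Y \<in> Obj C; Z \<in> Obj C; f \<in> Hom C X Y; g \<in> Hom C Y Z\<rbrakk>
        \<Longrightarrow> Comp C X Y Z g f \<in> Hom C X Z"
    and Comp_Ident_left:
      "\<lbrakk>X \<in> Obj C; Y \<in> Obj C; f \<in> Hom C X Y\<rbrakk> \<Longrightarrow> Comp C X Y Y (Ident C Y) f = f"
    and Comp_Ident_right:
      "\<lbrakk>X \<in> Obj C; Y \<in> Obj C; f \<in> Hom C X Y\<rbrakk> \<Longrightarrow> Comp C X X Y f (Ident C X) = f"
    and Comp_assoc:
      "\<lbrakk>W \<in> Obj C; X \<in> Obj C; Y \<in> Obj C; Z \<in> Obj C;
        f \<in> Hom C W X; g \<in> Hom C X Y; h \<in> Hom C Y Z\<rbrakk>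
        \<Longrightarrow> Comp C W X Z (Comp C X Y Z h g) f = Comp C W Y Z h (Comp C W X Y g f)"

record ('o, 'm, 'p, 'n) ftor =
  on_obj :: "'o \<Rightarrow> 'p"
  on_hom :: "'o \<Rightarrow> 'o \<Rightarrow> 'm \<Rightarrow> 'n"

locale is_functor = dom: category C + cod: category D
  for C :: "('o, 'm) cat" and D :: "('p, 'n) cat" +
  fixes F :: "('o, 'm, 'p, 'n) ftor"
  assumes on_obj_in_Obj: "X \<in> Obj C \<Longrightarrow> on_obj F X \<in> Obj D"
    and on_hom_in_Hom:
      "\<lbrakk>X \<in> Obj C; Y \<in> Obj C; f \<in> Hom C X Y\<rbrakk>
        \<Longrightarrow> on_hom F X Y f \<in> Hom D (on_obj F X) (on_obj F Y)"
    and on_hom_Ident: "X \<in> Obj C \<Longrightarrow> on_hom F X X (Ident C X) = Ident D (on_obj F X)"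
    and on_hom_Comp:
      "\<lbrakk>X \<in> Obj C; Y \<in> Obj C; Z \<in> Obj C; f \<in> Hom C X Y; g \<in> Hom C Y Z\<rbrakk>
        \<Longrightarrow> on_hom F X Z (Comp C X Y Z g f)
          = Comp D (on_obj F X) (on_obj F Y) (on_obj F Z) (on_hom F Y Z g) (on_hom F X Y f)"

definition ftor_comp ::
    "('p, 'n, 'q, 'l) ftor \<Rightarrow> ('o, 'm, 'p, 'n) ftor \<Rightarrow> ('o, 'm, 'q, 'l) ftor"
    (infixr \<open>\<circ>\<^sub>F\<close> 55) where
  "G \<circ>\<^sub>F F = \<lparr>on_obj = (\<lambda>X. on_obj G (on_obj F X)),
     on_hom = (\<lambda>X Y f. on_hom G (on_obj F X) (on_obj F Y) (on_hom F X Y f))\<rparr>"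

definition is_isomorphism :: "('o, 'm) cat \<Rightarrow> 'o \<Rightarrow> 'o \<Rightarrow> 'm \<Rightarrow> bool" where
  "is_isomorphism C X Y f \<longleftrightarrow> f \<in> Hom C X Y \<and>
     (\<exists>g \<in> Hom C Y X. Comp C X Y X g f = Ident C X \<and> Comp C Y X Y f g = Ident C Y)"

locale natural_isomorphism = source: is_functor C D F + target: is_functor C D G
  for C :: "('o, 'm) cat" and D :: "('p, 'n) cat"
    and F :: "('o, 'm, 'p, 'n) ftor" and G :: "('o, 'm, 'p, 'n) ftor" +
  fixes \<eta> :: "'o \<Rightarrow> 'n"
  assumes component_iso:
      "X \<in> Obj C \<Longrightarrow> is_isomorphism D (on_obj F X) (on_obj G X) (\<eta> X)"
    and naturality:
      "\<lbrakk>X \<in> Obj C; Y \<in> Obj C; f \<in> Hom C X Y\<rbrakk>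
        \<Longrightarrow> Comp D (on_obj F X) (on_obj G X) (on_obj G Y) (on_hom G X Y f) (\<eta> X)
          = Comp D (on_obj F X) (on_obj F Y) (on_obj G Y) (\<eta> Y) (on_hom F X Y f)"

definition naturally_isomorphic ::
    "('o, 'm) cat \<Rightarrow> ('p, 'n) cat \<Rightarrow> ('o, 'm, 'p, 'n) ftor \<Rightarrow> ('o, 'm, 'p, 'n) ftor \<Rightarrow> bool" where
  "naturally_isomorphic C D F G \<longleftrightarrow> (\<exists>\<eta>. natural_isomorphism C D F G \<eta>)"

text \<open>
  A category of sets with structure: \<open>U X\<close> is the underlying set of the object \<open>X\<close>, and
  \<open>P X Y f\<close> says that \<open>f\<close> respects the structure. Arrows are extensional maps, so that two arrows
  are equal as soon as they agree on the underlying set of their domain.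
\<close>

definition concrete_cat ::
    "'o set \<Rightarrow> ('o \<Rightarrow> 'a set) \<Rightarrow> ('o \<Rightarrow> 'o \<Rightarrow> ('a \<Rightarrow> 'a) \<Rightarrow> bool) \<Rightarrow> ('o, 'a \<Rightarrow> 'a) cat" where
  "concrete_cat Os U P = \<lparr>Obj = Os,
     Hom = (\<lambda>X Y. {f \<in> U X \<rightarrow>\<^sub>E U Y. P X Y f}),
     Ident = (\<lambda>X. \<lambda>x \<in> U X. x),
     Comp = (\<lambda>X Y Z g f. compose (U X) g f)\<rparr>"

section \<open>Linear maps and tensor products\<close>

text \<open>
  Vector spaces over the field \<open>K\<close> are the \<open>K\<close>-modules of HOL-Algebra. Its record of
  modules extends the record of rings; the fields \<open>mult\<close> and \<open>one\<close> of a module are never used.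
\<close>

definition char_zero :: "('k, 'r) ring_scheme \<Rightarrow> bool" where
  "char_zero K \<longleftrightarrow> (\<forall>n::nat. 0 < n \<longrightarrow> [n] \<cdot>\<^bsub>K\<^esub> \<one>\<^bsub>K\<^esub> \<noteq> \<zero>\<^bsub>K\<^esub>)"

definition ground_module :: "('k, 'r) ring_scheme \<Rightarrow> ('k, 'k) module" where
  "ground_module K = \<lparr>carrier = carrier K, mult = mult K, one = one K, zero = zero K,
     add = add K, smult = mult K\<rparr>"

definition linear_map ::
    "('k, 'r) ring_scheme \<Rightarrow> ('k, 'a, 'm) module_scheme \<Rightarrow> ('k, 'b, 'n) module_scheme
      \<Rightarrow> ('a \<Rightarrow> 'b) \<Rightarrow> bool" where
  "linear_map K M N f \<longleftrightarrow> f \<in> carrier M \<rightarrow> carrier N \<and>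
     (\<forall>x \<in> carrier M. \<forall>y \<in> carrier M. f (x \<oplus>\<^bsub>M\<^esub> y) = f x \<oplus>\<^bsub>N\<^esub> f y) \<and>
     (\<forall>c \<in> carrier K. \<forall>x \<in> carrier M. f (c \<odot>\<^bsub>M\<^esub> x) = c \<odot>\<^bsub>N\<^esub> f x)"

definition bilinear_map ::
    "('k, 'r) ring_scheme \<Rightarrow> ('k, 'a, 'm) module_scheme \<Rightarrow> ('k, 'b, 'n) module_scheme
      \<Rightarrow> ('k, 'c, 'p) module_scheme \<Rightarrow> ('a \<Rightarrow> 'b \<Rightarrow> 'c) \<Rightarrow> bool" where
  "bilinear_map K M N P f \<longleftrightarrow>
     (\<forall>x \<in> carrier M. linear_map K N P (\<lambda>y. f x y)) \<and>
     (\<forall>y \<in> carrier N. linear_map K M P (\<lambda>x. f x y))"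

text \<open>The free module on a set \<open>X\<close>: functions with finite support contained in \<open>X\<close>.\<close>

definition free_module :: "('k, 'r) ring_scheme \<Rightarrow> 'x set \<Rightarrow> ('k, 'x \<Rightarrow> 'k) module" where
  "free_module K X = \<lparr>
     carrier = {u. (\<forall>x. u x \<in> carrier K) \<and> finite {x. u x \<noteq> \<zero>\<^bsub>K\<^esub>} \<and> {x. u x \<noteq> \<zero>\<^bsub>K\<^esub>} \<subseteq> X},
     mult = undefined, one = undefined,
     zero = (\<lambda>x. \<zero>\<^bsub>K\<^esub>),
     add = (\<lambda>u v x. u x \<oplus>\<^bsub>K\<^esub> v x),
     smult = (\<lambda>c u x. c \<otimes>\<^bsub>K\<^esub> u x)\<rparr>"

definition basis_vec :: "('k, 'r) ring_scheme \<Rightarrow> 'x \<Rightarrow> 'x \<Rightarrow> 'k" where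
  "basis_vec K p = (\<lambda>q. if q = p then \<one>\<^bsub>K\<^esub> else \<zero>\<^bsub>K\<^esub>)"

definition quotient_module ::
    "('k, 'a, 'm) module_scheme \<Rightarrow> 'a set \<Rightarrow> ('k, 'a set) module" where
  "quotient_module M H = \<lparr>
     carrier = a_rcosets\<^bsub>M\<^esub> H,
     mult = undefined, one = undefined,
     zero = H,
     add = (\<lambda>X Y. X <+>\<^bsub>M\<^esub> Y),
     smult = (\<lambda>c X. \<Union>u \<in> X. H +>\<^bsub>M\<^esub> (c \<odot>\<^bsub>M\<^esub> u))\<rparr>"

definition tensor_relations ::
    "('k, 'r) ring_scheme \<Rightarrow> ('k, 'a, 'm) module_scheme \<Rightarrow> ('k, 'b, 'n) module_scheme
      \<Rightarrow> ('a \<times> 'b \<Rightarrow> 'k) set" where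
  "tensor_relations K M N =
    (let F = free_module K (carrier M \<times> carrier N); e = basis_vec K in
      {e (x \<oplus>\<^bsub>M\<^esub> x', y) \<ominus>\<^bsub>F\<^esub> (e (x, y) \<oplus>\<^bsub>F\<^esub> e (x', y)) | x x' y.
         x \<in> carrier M \<and> x' \<in> carrier M \<and> y \<in> carrier N} \<union>
      {e (x, y \<oplus>\<^bsub>N\<^esub> y') \<ominus>\<^bsub>F\<^esub> (e (x, y) \<oplus>\<^bsub>F\<^esub> e (x, y')) | x y y'.
         x \<in> carrier M \<and> y \<in> carrier N \<and> y' \<in> carrier N} \<union>
      {e (c \<odot>\<^bsub>M\<^esub> x, y) \<ominus>\<^bsub>F\<^esub> (c \<odot>\<^bsub>F\<^esub> e (x, y)) | c x y.
         c \<in> carrier K \<and> x \<in> carrier M \<and> y \<in> carrier N} \<union>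
      {e (x, c \<odot>\<^bsub>N\<^esub> y) \<ominus>\<^bsub>F\<^esub> (c \<odot>\<^bsub>F\<^esub> e (x, y)) | c x y.
         c \<in> carrier K \<and> x \<in> carrier M \<and> y \<in> carrier N})"

definition tensor_kernel ::
    "('k, 'r) ring_scheme \<Rightarrow> ('k, 'a, 'm) module_scheme \<Rightarrow> ('k, 'b, 'n) module_scheme
      \<Rightarrow> ('a \<times> 'b \<Rightarrow> 'k) set" where
  "tensor_kernel K M N =
     \<Inter>{H. submodule H K (free_module K (carrier M \<times> carrier N)) \<and> tensor_relations K M N \<subseteq> H}"

definition tensor_module ::
    "('k, 'r) ring_scheme \<Rightarrow> ('k, 'a, 'm) module_scheme \<Rightarrow> ('k, 'b, 'n) module_scheme
      \<Rightarrow> ('k, ('a \<times> 'b \<Rightarrow> 'k) set) module" where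
  "tensor_module K M N =
     quotient_module (free_module K (carrier M \<times> carrier N)) (tensor_kernel K M N)"

definition tensor ::
    "('k, 'r) ring_scheme \<Rightarrow> ('k, 'a, 'm) module_scheme \<Rightarrow> ('k, 'b, 'n) module_scheme
      \<Rightarrow> 'a \<Rightarrow> 'b \<Rightarrow> ('a \<times> 'b \<Rightarrow> 'k) set" where
  "tensor K M N x y =
     tensor_kernel K M N +>\<^bsub>free_module K (carrier M \<times> carrier N)\<^esub> basis_vec K (x, y)"

text \<open>
  The value at \<open>T \<in> M \<otimes> N\<close> of the linear map \<open>M \<otimes> N \<rightarrow> P\<close> induced by a bilinear map \<open>f\<close>.
  The sum does not depend on the representative \<open>u\<close> of \<open>T\<close> when \<open>f\<close> is bilinear.
\<close>

definition tensor_lift ::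
    "('k, 'c, 'p) module_scheme \<Rightarrow> ('k, 'r) ring_scheme \<Rightarrow> ('a \<Rightarrow> 'b \<Rightarrow> 'c)
      \<Rightarrow> ('a \<times> 'b \<Rightarrow> 'k) set \<Rightarrow> 'c" where
  "tensor_lift P K f T = (THE p. \<exists>u \<in> T.
     p = (\<Oplus>\<^bsub>P\<^esub>q \<in> {q. u q \<noteq> \<zero>\<^bsub>K\<^esub>}. u q \<odot>\<^bsub>P\<^esub> f (fst q) (snd q)))"

section \<open>Coalgebras\<close>

record ('k, 'a) coalgebra = "('k, 'a) module" +
  comult :: "'a \<Rightarrow> ('a \<times> 'a \<Rightarrow> 'k) set"
  counit :: "'a \<Rightarrow> 'k"

abbreviation tensor_square ::
    "('k, 'r) ring_scheme \<Rightarrow> ('k, 'a, 'm) module_scheme \<Rightarrow> ('k, ('a \<times> 'a \<Rightarrow> 'k) set) module" where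
  "tensor_square K M \<equiv> tensor_module K M M"

text \<open>
  Sweedler notation: for \<open>f\<close> bilinear with values in \<open>P\<close>, \<open>sweedler P K C a f\<close> is the
  sum of the \<open>f a\<^sub>(\<^sub>1\<^sub>) a\<^sub>(\<^sub>2\<^sub>)\<close> over \<open>(a)\<close>.
\<close>

definition sweedler ::
    "('k, 'c, 'p) module_scheme \<Rightarrow> ('k, 'r) ring_scheme \<Rightarrow> ('k, 'a, 'm) coalgebra_scheme
      \<Rightarrow> 'a \<Rightarrow> ('a \<Rightarrow> 'a \<Rightarrow> 'c) \<Rightarrow> 'c" where
  "sweedler P K C a f = tensor_lift P K f (comult C a)"

text \<open>
  Coassociativity is stated in \<open>C \<otimes> (C \<otimes> C)\<close>, with \<open>(x \<otimes> y) \<otimes> z\<close> in \<open>(C \<otimes> C) \<otimes> C\<close> identified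
  with \<open>x \<otimes> (y \<otimes> z)\<close>.
\<close>

locale cocommutative_coalgebra = module K C
  for K :: "('k, 'r) ring_scheme" and C :: "('k, 'a, 'm) coalgebra_scheme" +
  assumes comult_linear: "linear_map K C (tensor_square K C) (comult C)"
    and counit_linear: "linear_map K C (ground_module K) (counit C)"
    and coassociative:
      "a \<in> carrier C \<Longrightarrow>
        sweedler (tensor_module K C (tensor_square K C)) K C a (\<lambda>a1 a2.
          sweedler (tensor_module K C (tensor_square K C)) K C a1 (\<lambda>a11 a12.
            tensor K C (tensor_square K C) a11 (tensor K C C a12 a2)))
        = sweedler (tensor_module K C (tensor_square K C)) K C a (\<lambda>a1 a2.
            sweedler (tensor_module K C (tensor_square K C)) K C a2 (\<lambda>a21 a22.
              tensor K C (tensor_square K C) a1 (tensor K C C a21 a22)))"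
    and counit_left: "a \<in> carrier C \<Longrightarrow> sweedler C K C a (\<lambda>a1 a2. counit C a1 \<odot>\<^bsub>C\<^esub> a2) = a"
    and counit_right: "a \<in> carrier C \<Longrightarrow> sweedler C K C a (\<lambda>a1 a2. counit C a2 \<odot>\<^bsub>C\<^esub> a1) = a"
    and cocommutative:
      "a \<in> carrier C \<Longrightarrow>
        sweedler (tensor_square K C) K C a (\<lambda>a1 a2. tensor K C C a2 a1) = comult C a"

definition coalgebra_morphism ::
    "('k, 'r) ring_scheme \<Rightarrow> ('k, 'a, 'm) coalgebra_scheme \<Rightarrow> ('k, 'b, 'n) coalgebra_scheme
      \<Rightarrow> ('a \<Rightarrow> 'b) \<Rightarrow> bool" where
  "coalgebra_morphism K C D f \<longleftrightarrow> linear_map K C D f \<and>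
     (\<forall>a \<in> carrier C.
        comult D (f a) = sweedler (tensor_square K D) K C a (\<lambda>a1 a2. tensor K D D (f a1) (f a2)) \<and>
        counit D (f a) = counit C a)"

text \<open>The same set serves for the group-like and for the set-like elements.\<close>

definition grouplikes :: "('k, 'r) ring_scheme \<Rightarrow> ('k, 'a, 'm) coalgebra_scheme \<Rightarrow> 'a set" where
  "grouplikes K C =
     {g \<in> carrier C. comult C g = tensor K C C g g \<and> counit C g = \<one>\<^bsub>K\<^esub>}"

section \<open>Cocommutative Hopf dialgebras\<close>

record ('k, 'a) hopf_dialgebra = "('k, 'a) coalgebra" +
  bar_unit :: 'a  (\<open>\<xi>\<index>\<close>)
  lprod :: "'a \<Rightarrow> 'a \<Rightarrow> 'a"  (infixl \<open>\<turnstile>\<index>\<close> 70)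
  rprod :: "'a \<Rightarrow> 'a \<Rightarrow> 'a"  (infixl \<open>\<stileturn>\<index>\<close> 70)
  antipode :: "'a \<Rightarrow> 'a"

text \<open>Compatibility of a bilinear product \<open>C \<otimes> C \<rightarrow> C\<close> with comultiplication and counit.\<close>

definition coalgebra_product ::
    "('k, 'r) ring_scheme \<Rightarrow> ('k, 'a, 'm) coalgebra_scheme \<Rightarrow> ('a \<Rightarrow> 'a \<Rightarrow> 'a) \<Rightarrow> bool" where
  "coalgebra_product K C p \<longleftrightarrow> bilinear_map K C C C p \<and>
     (\<forall>a \<in> carrier C. \<forall>b \<in> carrier C.
        comult C (p a b) =
          sweedler (tensor_square K C) K C a (\<lambda>a1 a2.
            sweedler (tensor_square K C) K C b (\<lambda>b1 b2.
              tensor K C C (p a1 b1) (p a2 b2))) \<and>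
        counit C (p a b) = counit C a \<otimes>\<^bsub>K\<^esub> counit C b)"

locale cocommutative_hopf_dialgebra = cocommutative_coalgebra K A
  for K :: "('k, 'r) ring_scheme" and A :: "('k, 'a, 'm) hopf_dialgebra_scheme" (structure) +
  assumes lprod_coalgebra: "coalgebra_product K A (lprod A)"
    and rprod_coalgebra: "coalgebra_product K A (rprod A)"
    and bar_unit_grouplike: "\<xi> \<in> grouplikes K A"
    and antipode_morphism: "coalgebra_morphism K A A (antipode A)"
    and lprod_assoc:
      "\<lbrakk>a \<in> carrier A; b \<in> carrier A; c \<in> carrier A\<rbrakk> \<Longrightarrow> (a \<turnstile> b) \<turnstile> c = a \<turnstile> (b \<turnstile> c)"
    and rprod_assoc:
      "\<lbrakk>a \<in> carrier A; b \<in> carrier A; c \<in> carrier A\<rbrakk> \<Longrightarrow> (a \<stileturn> b) \<stileturn> c = a \<stileturn> (b \<stileturn> c)"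
    and bar_left:
      "\<lbrakk>a \<in> carrier A; b \<in> carrier A; c \<in> carrier A\<rbrakk> \<Longrightarrow> (a \<turnstile> b) \<turnstile> c = (a \<stileturn> b) \<turnstile> c"
    and bar_right:
      "\<lbrakk>a \<in> carrier A; b \<in> carrier A; c \<in> carrier A\<rbrakk> \<Longrightarrow> a \<stileturn> (b \<stileturn> c) = a \<stileturn> (b \<turnstile> c)"
    and inner_assoc:
      "\<lbrakk>a \<in> carrier A; b \<in> carrier A; c \<in> carrier A\<rbrakk> \<Longrightarrow> (a \<turnstile> b) \<stileturn> c = a \<turnstile> (b \<stileturn> c)"
    and bar_unit_left: "a \<in> carrier A \<Longrightarrow> \<xi> \<turnstile> a = a"
    and bar_unit_right: "a \<in> carrier A \<Longrightarrow> a \<stileturn> \<xi> = a"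
    and bar_unit_balanced: "a \<in> carrier A \<Longrightarrow> a \<turnstile> \<xi> = \<xi> \<stileturn> a"
    and antipode_right:
      "a \<in> carrier A \<Longrightarrow>
        sweedler A K A a (\<lambda>a1 a2. a1 \<turnstile> antipode A a2) = counit A a \<odot>\<^bsub>A\<^esub> \<xi>"
    and antipode_left:
      "a \<in> carrier A \<Longrightarrow>
        sweedler A K A a (\<lambda>a1 a2. antipode A a1 \<stileturn> a2) = counit A a \<odot>\<^bsub>A\<^esub> \<xi>"

definition hopf_dialgebra_morphism ::
    "('k, 'r) ring_scheme \<Rightarrow> ('k, 'a) hopf_dialgebra \<Rightarrow> ('k, 'b) hopf_dialgebra
      \<Rightarrow> ('a \<Rightarrow> 'b) \<Rightarrow> bool" where
  "hopf_dialgebra_morphism K A B f \<longleftrightarrow> coalgebra_morphism K A B f \<and>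
     f \<xi>\<^bsub>A\<^esub> = \<xi>\<^bsub>B\<^esub> \<and>
     (\<forall>a \<in> carrier A. \<forall>b \<in> carrier A.
        f (a \<turnstile>\<^bsub>A\<^esub> b) = f a \<turnstile>\<^bsub>B\<^esub> f b \<and> f (a \<stileturn>\<^bsub>A\<^esub> b) = f a \<stileturn>\<^bsub>B\<^esub> f b) \<and>
     (\<forall>a \<in> carrier A. f (antipode A a) = antipode B (f a))"

text \<open>
  The objects are the Hopf dialgebras whose underlying set is a subset of \<open>'a\<close>. As \<open>'a\<close> is
  arbitrary, it plays the role of the universe of sets.
\<close>

definition HopfDialg ::
    "('k, 'r) ring_scheme \<Rightarrow> (('k, 'a) hopf_dialgebra, 'a \<Rightarrow> 'a) cat" where
  "HopfDialg K =
     concrete_cat {A. cocommutative_hopf_dialgebra K A} carrier (hopf_dialgebra_morphism K)"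

section \<open>Racks, and the rack of set-like elements\<close>

record 'a rack = "'a partial_object" +
  rack_op :: "'a \<Rightarrow> 'a \<Rightarrow> 'a"  (infixr \<open>\<triangleright>\<index>\<close> 70)

locale is_rack =
  fixes X :: "('a, 'm) rack_scheme" (structure)
  assumes rack_nonempty: "carrier X \<noteq> {}"
    and left_translation_bij: "x \<in> carrier X \<Longrightarrow> bij_betw (\<lambda>y. x \<triangleright> y) (carrier X) (carrier X)"
    and self_distributive:
      "\<lbrakk>x \<in> carrier X; y \<in> carrier X; z \<in> carrier X\<rbrakk>
        \<Longrightarrow> x \<triangleright> (y \<triangleright> z) = (x \<triangleright> y) \<triangleright> (x \<triangleright> z)"

definition Rack :: "('a rack, 'a \<Rightarrow> 'a) cat" where
  "Rack = concrete_cat {X. is_rack X} carrier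
     (\<lambda>X Y f. \<forall>x \<in> carrier X. \<forall>y \<in> carrier X. f (x \<triangleright>\<^bsub>X\<^esub> y) = f x \<triangleright>\<^bsub>Y\<^esub> f y)"

text \<open>
  The data \<open>(B, \<Delta>, \<epsilon>, \<xi>, \<triangleright>)\<close> of a rack bialgebra; forming its set-like elements does not
  involve the axioms.
\<close>

record ('k, 'a) rack_bialgebra = "('k, 'a) coalgebra" +
  rb_unit :: 'a
  rb_op :: "'a \<Rightarrow> 'a \<Rightarrow> 'a"

definition Adj ::
    "('k, 'r) ring_scheme \<Rightarrow> ('k, 'a) hopf_dialgebra \<Rightarrow> ('k, 'a) rack_bialgebra" where
  "Adj K A = \<lparr>
     carrier = carrier A, mult = mult A, one = one A, zero = zero A, add = add A, smult = smult A,
     comult = comult A, counit = counit A,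
     rb_unit = \<xi>\<^bsub>A\<^esub>,
     rb_op = (\<lambda>a b. sweedler A K A a (\<lambda>a1 a2. (a1 \<turnstile>\<^bsub>A\<^esub> b) \<stileturn>\<^bsub>A\<^esub> antipode A a2))\<rparr>"

definition Slike :: "('k, 'r) ring_scheme \<Rightarrow> ('k, 'a) rack_bialgebra \<Rightarrow> 'a rack" where
  "Slike K B = \<lparr>carrier = grouplikes K B, rack_op = rb_op B\<rparr>"

definition SlikeAdj_functor ::
    "('k, 'r) ring_scheme \<Rightarrow> (('k, 'a) hopf_dialgebra, 'a \<Rightarrow> 'a, 'a rack, 'a \<Rightarrow> 'a) ftor" where
  "SlikeAdj_functor K = \<lparr>on_obj = (\<lambda>A. Slike K (Adj K A)),
     on_hom = (\<lambda>A B f. restrict f (carrier (Slike K (Adj K A))))\<rparr>"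

section \<open>Generalized digroups and digroups\<close>

record 'a gdigroup = "'a partial_object" +
  dleft :: "'a \<Rightarrow> 'a \<Rightarrow> 'a"  (infixl \<open>\<turnstile>\<^sub>D\<index>\<close> 70)
  dright :: "'a \<Rightarrow> 'a \<Rightarrow> 'a"  (infixl \<open>\<stileturn>\<^sub>D\<index>\<close> 70)

definition Halo :: "('a, 'm) gdigroup_scheme \<Rightarrow> 'a set" where
  "Halo D = {e \<in> carrier D. \<forall>x \<in> carrier D. x \<stileturn>\<^sub>D\<^bsub>D\<^esub> e = x \<and> e \<turnstile>\<^sub>D\<^bsub>D\<^esub> x = x}"

locale generalized_digroup =
  fixes D :: "('a, 'm) gdigroup_scheme" (structure)
  assumes nonempty: "carrier D \<noteq> {}"
    and dleft_closed: "\<lbrakk>x \<in> carrier D; y \<in> carrier D\<rbrakk> \<Longrightarrow> x \<turnstile>\<^sub>D y \<in> carrier D"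
    and dright_closed: "\<lbrakk>x \<in> carrier D; y \<in> carrier D\<rbrakk> \<Longrightarrow> x \<stileturn>\<^sub>D y \<in> carrier D"
    and dleft_assoc:
      "\<lbrakk>x \<in> carrier D; y \<in> carrier D; z \<in> carrier D\<rbrakk> \<Longrightarrow> (x \<turnstile>\<^sub>D y) \<turnstile>\<^sub>D z = x \<turnstile>\<^sub>D (y \<turnstile>\<^sub>D z)"
    and dright_assoc:
      "\<lbrakk>x \<in> carrier D; y \<in> carrier D; z \<in> carrier D\<rbrakk> \<Longrightarrow> (x \<stileturn>\<^sub>D y) \<stileturn>\<^sub>D z = x \<stileturn>\<^sub>D (y \<stileturn>\<^sub>D z)"
    and inner_assoc:
      "\<lbrakk>x \<in> carrier D; y \<in> carrier D; z \<in> carrier D\<rbrakk> \<Longrightarrow> x \<turnstile>\<^sub>D (y \<stileturn>\<^sub>D z) = (x \<turnstile>\<^sub>D y) \<stileturn>\<^sub>D z"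
    and bar_right:
      "\<lbrakk>x \<in> carrier D; y \<in> carrier D; z \<in> carrier D\<rbrakk> \<Longrightarrow> x \<stileturn>\<^sub>D (y \<stileturn>\<^sub>D z) = x \<stileturn>\<^sub>D (y \<turnstile>\<^sub>D z)"
    and bar_left:
      "\<lbrakk>x \<in> carrier D; y \<in> carrier D; z \<in> carrier D\<rbrakk> \<Longrightarrow> (x \<turnstile>\<^sub>D y) \<turnstile>\<^sub>D z = (x \<stileturn>\<^sub>D y) \<turnstile>\<^sub>D z"
    and Halo_nonempty: "Halo D \<noteq> {}"
    and right_inverse_ex: "\<lbrakk>e \<in> Halo D; x \<in> carrier D\<rbrakk> \<Longrightarrow> \<exists>y \<in> carrier D. x \<turnstile>\<^sub>D y = e"
    and left_inverse_ex: "\<lbrakk>e \<in> Halo D; x \<in> carrier D\<rbrakk> \<Longrightarrow> \<exists>y \<in> carrier D. y \<stileturn>\<^sub>D x = e"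

definition gDig_morphism ::
    "('a, 'm) gdigroup_scheme \<Rightarrow> ('b, 'n) gdigroup_scheme \<Rightarrow> ('a \<Rightarrow> 'b) \<Rightarrow> bool" where
  "gDig_morphism D E f \<longleftrightarrow>
     (\<forall>x \<in> carrier D. \<forall>y \<in> carrier D.
        f (x \<turnstile>\<^sub>D\<^bsub>D\<^esub> y) = f x \<turnstile>\<^sub>D\<^bsub>E\<^esub> f y \<and> f (x \<stileturn>\<^sub>D\<^bsub>D\<^esub> y) = f x \<stileturn>\<^sub>D\<^bsub>E\<^esub> f y) \<and>
     (\<forall>e \<in> Halo D. f e \<in> Halo E)"

definition gDig :: "('a gdigroup, 'a \<Rightarrow> 'a) cat" where
  "gDig = concrete_cat {D. generalized_digroup D} carrier gDig_morphism"

record 'a digroup = "'a gdigroup" +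
  dunit :: 'a

definition is_digroup_inverse :: "('a, 'm) digroup_scheme \<Rightarrow> 'a \<Rightarrow> 'a \<Rightarrow> bool" where
  "is_digroup_inverse D x y \<longleftrightarrow>
     y \<in> carrier D \<and> x \<turnstile>\<^sub>D\<^bsub>D\<^esub> y = dunit D \<and> y \<stileturn>\<^sub>D\<^bsub>D\<^esub> x = dunit D"

locale is_digroup = generalized_digroup D for D :: "('a, 'm) digroup_scheme" (structure) +
  assumes dunit_bar_unit: "dunit D \<in> Halo D"
    and inverse_ex1: "x \<in> carrier D \<Longrightarrow> \<exists>!y. is_digroup_inverse D x y"

definition Dig :: "('a digroup, 'a \<Rightarrow> 'a) cat" where
  "Dig = concrete_cat {D. is_digroup D} carrier
     (\<lambda>D E f. gDig_morphism D E f \<and> f (dunit D) = dunit E)"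

text \<open>\<open>gdigroup.truncate\<close> forgets the distinguished bar-unit.\<close>

definition Dig_inclusion :: "('a digroup, 'a \<Rightarrow> 'a, 'a gdigroup, 'a \<Rightarrow> 'a) ftor" where
  "Dig_inclusion = \<lparr>on_obj = gdigroup.truncate, on_hom = (\<lambda>D E f. f)\<rparr>"

definition Glike ::
    "('k, 'r) ring_scheme \<Rightarrow> ('k, 'a) hopf_dialgebra \<Rightarrow> 'a digroup" where
  "Glike K A = \<lparr>carrier = grouplikes K A, dleft = lprod A, dright = rprod A, dunit = \<xi>\<^bsub>A\<^esub>\<rparr>"

definition Glike_functor ::
    "('k, 'r) ring_scheme \<Rightarrow> (('k, 'a) hopf_dialgebra, 'a \<Rightarrow> 'a, 'a digroup, 'a \<Rightarrow> 'a) ftor" where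
  "Glike_functor K = \<lparr>on_obj = Glike K,
     on_hom = (\<lambda>A B f. restrict f (carrier (Glike K A)))\<rparr>"

definition one_sided_inverse :: "('a, 'm) gdigroup_scheme \<Rightarrow> 'a \<Rightarrow> 'a \<Rightarrow> bool" where
  "one_sided_inverse D x y \<longleftrightarrow>
     y \<in> carrier D \<and> (x \<turnstile>\<^sub>D\<^bsub>D\<^esub> y \<in> Halo D \<or> y \<stileturn>\<^sub>D\<^bsub>D\<^esub> x \<in> Halo D)"

text \<open>The conjugation product does not depend on the choice of the one-sided inverse.\<close>

definition Conj :: "'a gdigroup \<Rightarrow> 'a rack" where
  "Conj D = \<lparr>carrier = carrier D,
     rack_op = (\<lambda>x y. (x \<turnstile>\<^sub>D\<^bsub>D\<^esub> y) \<stileturn>\<^sub>D\<^bsub>D\<^esub> (SOME z. one_sided_inverse D x z))\<rparr>"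

definition Conj_functor :: "('a gdigroup, 'a \<Rightarrow> 'a, 'a rack, 'a \<Rightarrow> 'a) ftor" where
  "Conj_functor = \<lparr>on_obj = Conj, on_hom = (\<lambda>D E f. f)\<rparr>"

end

theory Submission
  imports Defs
begin

text \<open>
  A group-like \<open>g\<close> has \<open>\<Delta>(g) = g \<otimes> g\<close>, so every Sweedler sum over \<open>(g)\<close> collapses to a single term.
  Hence \<open>Glike(A)\<close> is closed under the products, \<open>S(g)\<close> is an inverse of \<open>g\<close>, and the adjoint product
  is \<open>(g \<turnstile> h) \<stileturn> S(g)\<close>, which is conjugation in \<open>Glike(A)\<close> because the conjugation product may be
  computed with any one-sided inverse. The identity maps are therefore the components of the
  natural isomorphism. Evaluating a Sweedler sum is the universal property of the tensor product,
  which is here a quotient of a free module.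
\<close>

section \<open>Categories and functors\<close>

text \<open>Two independences of choice carry the argument. \<open>tensor_lift\<close> is a definite
  description over all representatives of a coset, so a Sweedler sum has a usable value only when
  its summand is bilinear; every collapse at a group-like is paid for by a bilinearity proof.
  \<open>Conj\<close> picks an inverse by \<open>SOME\<close>, and inverses of one element need not
  be equal, not even as left and right inverses for the same bar-unit. What they share is their
  action, by \<turnstile> from the left and by \<stileturn> from the right, and conjugation sees
  nothing else. A further obstacle is that \<open>gDig\<close> asks its morphisms to preserve every
  bar-unit, while a Hopf dialgebra morphism is only assumed to preserve \<xi>; the other bar-units
  have to be recognised by equations in \<xi>. The adjoint product and conjugation are compared on
  group-likes only. As rack axioms and arrows look at carriers alone, this agreement suffices both
  to transport the rack axioms to the set-like elements and to make identity maps invertible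
  arrows.\<close>

lemma is_functor_comp:
  assumes "is_functor C D F" "is_functor D E G"
  shows "is_functor C E (G \<circ>\<^sub>F F)"
proof -
  interpret F: is_functor C D F by fact
  interpret G: is_functor D E G by fact
  show ?thesis
    by unfold_locales
      (simp_all add: ftor_comp_def F.on_obj_in_Obj F.on_hom_in_Hom F.on_hom_Ident F.on_hom_Comp
        G.on_obj_in_Obj G.on_hom_in_Hom G.on_hom_Ident G.on_hom_Comp)
qed

lemma concrete_cat_sel [simp]:
  "Obj (concrete_cat Os U P) = Os"
  "Hom (concrete_cat Os U P) X Y = {f \<in> U X \<rightarrow>\<^sub>E U Y. P X Y f}"
  "Ident (concrete_cat Os U P) X = (\<lambda>x \<in> U X. x)"
  "Comp (concrete_cat Os U P) X Y Z g f = compose (U X) g f"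
  by (simp_all add: concrete_cat_def)

text \<open>Extensionality of arrows makes the unit and associativity laws hold as equations of
  functions, so what remains is stability of \<open>P\<close> under identities and
  composites.\<close>

lemma category_concrete_cat:
  assumes "\<And>X. X \<in> Os \<Longrightarrow> P X X (\<lambda>x \<in> U X. x)"
    and "\<And>X Y Z f g. \<lbrakk>X \<in> Os; Y \<in> Os; Z \<in> Os; f \<in> U X \<rightarrow> U Y; g \<in> U Y \<rightarrow> U Z; P X Y f; P Y Z g\<rbrakk>
      \<Longrightarrow> P X Z (compose (U X) g f)"
  shows "category (concrete_cat Os U P)"
proof
  fix W X Y Z f g h
  assume "W \<in> Obj (concrete_cat Os U P)" "X \<in> Obj (concrete_cat Os U P)"
    "Y \<in> Obj (concrete_cat Os U P)" "Z \<in> Obj (concrete_cat Os U P)"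
    "f \<in> Hom (concrete_cat Os U P) W X" "g \<in> Hom (concrete_cat Os U P) X Y"
    "h \<in> Hom (concrete_cat Os U P) Y Z"
  then show "Comp (concrete_cat Os U P) W X Z (Comp (concrete_cat Os U P) X Y Z h g) f
      = Comp (concrete_cat Os U P) W Y Z h (Comp (concrete_cat Os U P) W X Y g f)"
    by (auto simp: compose_def restrict_def Pi_iff PiE_iff fun_eq_iff)
qed (use assms in \<open>auto simp: compose_def restrict_def PiE_iff Pi_iff extensional_def fun_eq_iff\<close>)

text \<open>One scheme for all four functors: each restricts maps to a subset of the underlying set.
  Condition \<open>hom\<close> is asked of extensional \<open>f\<close> only, because such an
  \<open>f\<close> equals its restriction to its whole domain; this is how the inclusion of
  \<open>Dig\<close> and \<open>Conj\<close>, which leave arrows unchanged, fit in.\<close>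

lemma is_functor_restrict:
  assumes "category (concrete_cat Os U P)" "category (concrete_cat Ot V Q)"
    and obj: "\<And>X. X \<in> Os \<Longrightarrow> on_obj F X \<in> Ot"
    and sub: "\<And>X. X \<in> Os \<Longrightarrow> V (on_obj F X) \<subseteq> U X"
    and hom: "\<And>X Y f. \<lbrakk>X \<in> Os; Y \<in> Os; f \<in> U X \<rightarrow>\<^sub>E U Y; P X Y f\<rbrakk>
      \<Longrightarrow> on_hom F X Y f = restrict f (V (on_obj F X))"
    and maps: "\<And>X Y f. \<lbrakk>X \<in> Os; Y \<in> Os; f \<in> U X \<rightarrow> U Y; P X Y f\<rbrakk>
      \<Longrightarrow> f \<in> V (on_obj F X) \<rightarrow> V (on_obj F Y)"
    and mor: "\<And>X Y f. \<lbrakk>X \<in> Os; Y \<in> Os; f \<in> U X \<rightarrow> U Y; P X Y f\<rbrakk>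
      \<Longrightarrow> Q (on_obj F X) (on_obj F Y) (restrict f (V (on_obj F X)))"
  shows "is_functor (concrete_cat Os U P) (concrete_cat Ot V Q) F"
proof -
  interpret dom: category "concrete_cat Os U P" by fact
  interpret cod: category "concrete_cat Ot V Q" by fact
  show ?thesis
  proof
    fix X assume "X \<in> Obj (concrete_cat Os U P)"
    then have X: "X \<in> Os" by simp
    show "on_obj F X \<in> Obj (concrete_cat Ot V Q)" using obj[OF X] by simp
    have "P X X (\<lambda>x \<in> U X. x)" using dom.Ident_in_Hom[of X] X by simp
    then have "on_hom F X X (\<lambda>x \<in> U X. x) = restrict (\<lambda>x \<in> U X. x) (V (on_obj F X))"
      by (intro hom X) auto
    also have "\<dots> = (\<lambda>x \<in> V (on_obj F X). x)" using sub[OF X] by (auto simp: fun_eq_iff restrict_def)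
    finally show "on_hom F X X (Ident (concrete_cat Os U P) X)
        = Ident (concrete_cat Ot V Q) (on_obj F X)" by simp
  next
    fix X Y f
    assume "X \<in> Obj (concrete_cat Os U P)" "Y \<in> Obj (concrete_cat Os U P)"
      "f \<in> Hom (concrete_cat Os U P) X Y"
    then have XY: "X \<in> Os" "Y \<in> Os" and f: "f \<in> U X \<rightarrow>\<^sub>E U Y" "P X Y f" by auto
    have f': "f \<in> U X \<rightarrow> U Y" using f(1) by auto
    show "on_hom F X Y f \<in> Hom (concrete_cat Ot V Q) (on_obj F X) (on_obj F Y)"
      unfolding hom[OF XY f] using maps[OF XY f' f(2)] mor[OF XY f' f(2)] by auto
  next
    fix X Y Z f g
    assume *: "X \<in> Obj (concrete_cat Os U P)" "Y \<in> Obj (concrete_cat Os U P)"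
      "Z \<in> Obj (concrete_cat Os U P)"
      "f \<in> Hom (concrete_cat Os U P) X Y" "g \<in> Hom (concrete_cat Os U P) Y Z"
    then have XYZ: "X \<in> Os" "Y \<in> Os" "Z \<in> Os" and f: "f \<in> U X \<rightarrow>\<^sub>E U Y" "P X Y f"
      and g: "g \<in> U Y \<rightarrow>\<^sub>E U Z" "P Y Z g" by auto
    have "compose (U X) g f \<in> U X \<rightarrow>\<^sub>E U Z \<and> P X Z (compose (U X) g f)"
      using dom.Comp_in_Hom[OF *] by simp
    then have "on_hom F X Z (compose (U X) g f) = restrict (compose (U X) g f) (V (on_obj F X))"
      by (intro hom XYZ) auto
    moreover have "f \<in> V (on_obj F X) \<rightarrow> V (on_obj F Y)"
      using f by (intro maps XYZ) auto
    ultimately show "on_hom F X Z (Comp (concrete_cat Os U P) X Y Z g f)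
        = Comp (concrete_cat Ot V Q) (on_obj F X) (on_obj F Y) (on_obj F Z)
            (on_hom F Y Z g) (on_hom F X Y f)"
      using sub[OF XYZ(1)] hom[OF XYZ(1,2) f] hom[OF XYZ(2,3) g]
      by (auto simp: compose_def restrict_def fun_eq_iff Pi_iff subset_iff)
  qed
qed

section \<open>Linear maps\<close>

lemma linear_mapI:
  assumes "\<And>x. x \<in> carrier M \<Longrightarrow> f x \<in> carrier N"
    and "\<And>x y. x \<in> carrier M \<Longrightarrow> y \<in> carrier M \<Longrightarrow> f (x \<oplus>\<^bsub>M\<^esub> y) = f x \<oplus>\<^bsub>N\<^esub> f y"
    and "\<And>c x. c \<in> carrier K \<Longrightarrow> x \<in> carrier M \<Longrightarrow> f (c \<odot>\<^bsub>M\<^esub> x) = c \<odot>\<^bsub>N\<^esub> f x"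
  shows "linear_map K M N f"
  using assms unfolding linear_map_def by auto

lemma linear_mapD:
  assumes "linear_map K M N f"
  shows "x \<in> carrier M \<Longrightarrow> f x \<in> carrier N"
    and "x \<in> carrier M \<Longrightarrow> y \<in> carrier M \<Longrightarrow> f (x \<oplus>\<^bsub>M\<^esub> y) = f x \<oplus>\<^bsub>N\<^esub> f y"
    and "c \<in> carrier K \<Longrightarrow> x \<in> carrier M \<Longrightarrow> f (c \<odot>\<^bsub>M\<^esub> x) = c \<odot>\<^bsub>N\<^esub> f x"
  using assms unfolding linear_map_def by auto

lemma linear_map_compose:
  assumes "linear_map K M N f" "linear_map K N P g"
  shows "linear_map K M P (\<lambda>x. g (f x))"
  using assms unfolding linear_map_def by (auto simp: Pi_iff)

lemma linear_map_cong:
  assumes "module K M" "\<And>x. x \<in> carrier M \<Longrightarrow> f x = g x"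
  shows "linear_map K M N f \<longleftrightarrow> linear_map K M N g"
proof -
  interpret module K M by fact
  show ?thesis unfolding linear_map_def using assms(2) by (auto simp: Pi_iff)
qed

lemma linear_map_id: "module K M \<Longrightarrow> linear_map K M M (\<lambda>x. x)"
  by (simp add: linear_map_def)

lemma linear_map_zero:
  assumes "module K M" "module K N" "linear_map K M N f"
  shows "f \<zero>\<^bsub>M\<^esub> = \<zero>\<^bsub>N\<^esub>"
proof -
  interpret M: module K M by fact
  interpret N: module K N by fact
  have "f (\<zero>\<^bsub>K\<^esub> \<odot>\<^bsub>M\<^esub> \<zero>\<^bsub>M\<^esub>) = \<zero>\<^bsub>K\<^esub> \<odot>\<^bsub>N\<^esub> f \<zero>\<^bsub>M\<^esub>"
    by (rule linear_mapD(3)[OF assms(3)]) auto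
  then show ?thesis using linear_mapD(1)[OF assms(3)] by simp
qed

lemma linear_map_uminus:
  assumes "module K M" "module K N" "linear_map K M N f" "x \<in> carrier M"
  shows "f (\<ominus>\<^bsub>M\<^esub> x) = \<ominus>\<^bsub>N\<^esub> f x"
proof -
  interpret M: module K M by fact
  interpret N: module K N by fact
  have "f (\<ominus>\<^bsub>M\<^esub> x) \<oplus>\<^bsub>N\<^esub> f x = \<zero>\<^bsub>N\<^esub>"
    using linear_mapD(2)[OF assms(3), of "\<ominus>\<^bsub>M\<^esub> x" x] assms(4) linear_map_zero[OF assms(1-3)]
    by (simp add: M.l_neg)
  then show ?thesis
    using linear_mapD(1)[OF assms(3)] assms(4) by (simp add: N.minus_equality)
qed

text \<open>Prepares the use of minimality: \<open>tensor_kernel\<close> lies in every submodule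
  containing the relations, in particular in a suitable kernel.\<close>

lemma linear_map_kernel_submodule:
  assumes "module K M" "module K N" "linear_map K M N f"
  shows "submodule {x \<in> carrier M. f x = \<zero>\<^bsub>N\<^esub>} K M"
proof -
  interpret M: module K M by fact
  interpret N: module K N by fact
  show ?thesis
    using linear_mapD[OF assms(3)] linear_map_zero[OF assms] linear_map_uminus[OF assms]
    by (intro M.submoduleI) auto
qed

lemma bilinear_mapD:
  assumes "bilinear_map K M N P f"
  shows "x \<in> carrier M \<Longrightarrow> linear_map K N P (f x)"
    and "y \<in> carrier N \<Longrightarrow> linear_map K M P (\<lambda>x. f x y)"
    and "x \<in> carrier M \<Longrightarrow> y \<in> carrier N \<Longrightarrow> f x y \<in> carrier P"
  using assms unfolding bilinear_map_def by (auto dest: linear_mapD(1))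

lemma bilinear_map_cong:
  assumes "module K M" "module K N"
    and "\<And>x y. x \<in> carrier M \<Longrightarrow> y \<in> carrier N \<Longrightarrow> f x y = g x y"
  shows "bilinear_map K M N P f \<longleftrightarrow> bilinear_map K M N P g"
  unfolding bilinear_map_def using assms
  by (intro arg_cong2[where f="(\<and>)"] ball_cong linear_map_cong refl) auto

lemma bilinear_map_compose:
  assumes "bilinear_map K M N P f" "linear_map K P Q g"
  shows "bilinear_map K M N Q (\<lambda>x y. g (f x y))"
  using assms unfolding bilinear_map_def by (auto intro: linear_map_compose)

text \<open>Source of nearly all bilinearity facts below: the Sweedler summands have the shape
  \<open>f (g a1) (h a2)\<close> with \<open>f\<close> a product or \<open>tensor\<close>, and
  \<open>g\<close>, \<open>h\<close> linear.\<close>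

lemma bilinear_map_precompose:
  assumes "bilinear_map K M N P f" "linear_map K M' M g" "linear_map K N' N h"
  shows "bilinear_map K M' N' P (\<lambda>x y. f (g x) (h y))"
  unfolding bilinear_map_def
  using linear_map_compose[OF assms(2) bilinear_mapD(2)[OF assms(1)]]
    linear_map_compose[OF assms(3) bilinear_mapD(1)[OF assms(1)]]
    linear_mapD(1)[OF assms(2)] linear_mapD(1)[OF assms(3)]
  by simp

section \<open>Free modules\<close>

lemma free_module_sel [simp]:
  "zero (free_module K X) = (\<lambda>x. \<zero>\<^bsub>K\<^esub>)"
  "add (free_module K X) u v = (\<lambda>x. u x \<oplus>\<^bsub>K\<^esub> v x)"
  "smult (free_module K X) c u = (\<lambda>x. c \<otimes>\<^bsub>K\<^esub> u x)"
  by (simp_all add: free_module_def)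

lemma free_module_carrier:
  "u \<in> carrier (free_module K X) \<longleftrightarrow>
    (\<forall>x. u x \<in> carrier K) \<and> finite {x. u x \<noteq> \<zero>\<^bsub>K\<^esub>} \<and> (\<forall>x. x \<notin> X \<longrightarrow> u x = \<zero>\<^bsub>K\<^esub>)"
  by (auto simp add: free_module_def)

lemma module_free_module:
  assumes "cring K"
  shows "module K (free_module K X)"
proof -
  interpret K: cring K by fact
  have add: "u \<oplus>\<^bsub>free_module K X\<^esub> v \<in> carrier (free_module K X)"
    if "u \<in> carrier (free_module K X)" "v \<in> carrier (free_module K X)" for u v
  proof -
    have "{x. u x \<oplus>\<^bsub>K\<^esub> v x \<noteq> \<zero>\<^bsub>K\<^esub>} \<subseteq> {x. u x \<noteq> \<zero>\<^bsub>K\<^esub>} \<union> {x. v x \<noteq> \<zero>\<^bsub>K\<^esub>}"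
      by auto
    then show ?thesis using that by (auto simp: free_module_carrier intro: finite_subset)
  qed
  have smult: "c \<odot>\<^bsub>free_module K X\<^esub> u \<in> carrier (free_module K X)"
    if "c \<in> carrier K" "u \<in> carrier (free_module K X)" for c u
  proof -
    have "{x. c \<otimes>\<^bsub>K\<^esub> u x \<noteq> \<zero>\<^bsub>K\<^esub>} \<subseteq> {x. u x \<noteq> \<zero>\<^bsub>K\<^esub>}"
      using that by auto
    then show ?thesis using that by (auto simp: free_module_carrier intro: finite_subset)
  qed
  \<comment> \<open>Taking (-1)u as the negative reduces its finite support to the case of scalar
    multiples.\<close>
  have neg: "\<exists>v \<in> carrier (free_module K X). v \<oplus>\<^bsub>free_module K X\<^esub> u = \<zero>\<^bsub>free_module K X\<^esub>"
    if u: "u \<in> carrier (free_module K X)" for u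
  proof
    show "(\<ominus>\<^bsub>K\<^esub> \<one>\<^bsub>K\<^esub>) \<odot>\<^bsub>free_module K X\<^esub> u \<in> carrier (free_module K X)"
      by (rule smult) (use u in auto)
    show "(\<ominus>\<^bsub>K\<^esub> \<one>\<^bsub>K\<^esub>) \<odot>\<^bsub>free_module K X\<^esub> u \<oplus>\<^bsub>free_module K X\<^esub> u = \<zero>\<^bsub>free_module K X\<^esub>"
      using u by (auto simp: free_module_carrier K.l_minus K.l_neg)
  qed
  show ?thesis
  proof (rule moduleI)
    show "abelian_group (free_module K X)"
      using add neg
      by (intro abelian_groupI) (auto simp: free_module_carrier K.a_ac)
  qed (use assms smult in \<open>auto simp: free_module_carrier K.l_distr K.r_distr K.m_assoc\<close>)
qed

lemma basis_vec_in_carrier: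
  assumes "cring K" "p \<in> X"
  shows "basis_vec K p \<in> carrier (free_module K X)"
proof -
  interpret K: cring K by fact
  \<comment> \<open>Only an inclusion, since one = zero is possible in a commutative ring.\<close>
  have "{x. basis_vec K p x \<noteq> \<zero>\<^bsub>K\<^esub>} \<subseteq> {p}" by (auto simp: basis_vec_def)
  then have "finite {x. basis_vec K p x \<noteq> \<zero>\<^bsub>K\<^esub>}" by (rule finite_subset) simp
  then show ?thesis
    using assms(2) by (auto simp: free_module_carrier basis_vec_def)
qed

lemma linear_map_free_module_eq:
  assumes "module K P"
    and f: "linear_map K (free_module K X) P f" and g: "linear_map K (free_module K X) P g"
    and eq: "\<And>p. p \<in> X \<Longrightarrow> f (basis_vec K p) = g (basis_vec K p)"
    and u: "u \<in> carrier (free_module K X)"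
  shows "f u = g u"
proof -
  interpret P: module K P by fact
  let ?F = "free_module K X"
  have K: "cring K" by (rule P.is_cring)
  note F = module_free_module[OF K, of X]
  \<comment> \<open>The induction is over a finite superset \<open>S\<close> of the support instead
    of the support itself: removing the coordinate \<open>p\<close> then works uniformly, also when
    \<open>u p\<close> is already zero. The inductive step splits \<open>u\<close> into
    \<open>v\<close>, supported in the smaller set, and a multiple of a basis vector.\<close>
  have "f u = g u" if "finite S" "S \<subseteq> X" "u \<in> carrier ?F" "{x. u x \<noteq> \<zero>\<^bsub>K\<^esub>} \<subseteq> S" for S u
    using that
  proof (induction S arbitrary: u rule: finite_induct)
    case empty
    then have "u = \<zero>\<^bsub>?F\<^esub>" by auto
    then show ?case
      using linear_map_zero[OF F assms(1) f] linear_map_zero[OF F assms(1) g] by metis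
  next
    case (insert p S)
    define v where "v = u(p := \<zero>\<^bsub>K\<^esub>)"
    have v: "v \<in> carrier ?F"
    proof -
      have "{x. v x \<noteq> \<zero>\<^bsub>K\<^esub>} \<subseteq> {x. u x \<noteq> \<zero>\<^bsub>K\<^esub>}" by (auto simp: v_def)
      moreover have "finite {x. u x \<noteq> \<zero>\<^bsub>K\<^esub>}"
        using insert.prems by (simp add: free_module_carrier)
      ultimately have "finite {x. v x \<noteq> \<zero>\<^bsub>K\<^esub>}" by (rule finite_subset)
      then show ?thesis
        unfolding free_module_carrier v_def using insert.prems
        by (simp add: free_module_carrier)
    qed
    have "f v = g v"
      by (rule insert.IH[OF _ v]) (use insert.prems in \<open>auto simp: v_def\<close>)
    have p: "basis_vec K p \<in> carrier ?F"
      using insert.prems basis_vec_in_carrier[OF K] by auto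
    have c: "u p \<in> carrier K" using insert.prems by (auto simp: free_module_carrier)
    have pc: "u p \<odot>\<^bsub>?F\<^esub> basis_vec K p \<in> carrier ?F"
      using module.smult_closed[OF F c p] .
    have "u = v \<oplus>\<^bsub>?F\<^esub> u p \<odot>\<^bsub>?F\<^esub> basis_vec K p"
      using insert.prems by (auto simp: v_def basis_vec_def free_module_carrier fun_eq_iff)
    moreover have "f (v \<oplus>\<^bsub>?F\<^esub> u p \<odot>\<^bsub>?F\<^esub> basis_vec K p) = g (v \<oplus>\<^bsub>?F\<^esub> u p \<odot>\<^bsub>?F\<^esub> basis_vec K p)"
      unfolding linear_mapD(2)[OF f v pc] linear_mapD(2)[OF g v pc]
        linear_mapD(3)[OF f c p] linear_mapD(3)[OF g c p]
      using \<open>f v = g v\<close> eq insert.prems by simp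
    ultimately show ?case by simp
  qed
  then show ?thesis using u by (auto simp: free_module_carrier)
qed

text \<open>The sum inside \<open>tensor_lift\<close>, isolated as a map on the free module, where
  it can be studied before passing to cosets.\<close>

definition linear_extension ::
    "('k, 'c, 'p) module_scheme \<Rightarrow> ('k, 'r) ring_scheme \<Rightarrow> ('x \<Rightarrow> 'c) \<Rightarrow> ('x \<Rightarrow> 'k) \<Rightarrow> 'c" where
  "linear_extension P K f u = (\<Oplus>\<^bsub>P\<^esub>q \<in> {q. u q \<noteq> \<zero>\<^bsub>K\<^esub>}. u q \<odot>\<^bsub>P\<^esub> f q)"

text \<open>The supports of \<open>u\<close>, \<open>v\<close> and their sum differ; additivity
  becomes a statement about finite sums once all three run over one common index set.\<close>

lemma linear_extension_superset:
  assumes "module K P" "finite S" "{q. u q \<noteq> \<zero>\<^bsub>K\<^esub>} \<subseteq> S"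
    and "\<And>q. q \<in> S \<Longrightarrow> u q \<in> carrier K" "\<And>q. q \<in> S \<Longrightarrow> f q \<in> carrier P"
  shows "linear_extension P K f u = (\<Oplus>\<^bsub>P\<^esub>q \<in> S. u q \<odot>\<^bsub>P\<^esub> f q)"
proof -
  interpret P: module K P by fact
  show ?thesis unfolding linear_extension_def
    by (rule P.add.finprod_mono_neutral_cong_left) (use assms in auto)
qed

lemma linear_extension_basis_vec:
  assumes "module K P" "f p \<in> carrier P"
  shows "linear_extension P K f (basis_vec K p) = f p"
proof -
  interpret P: module K P by fact
  have "linear_extension P K f (basis_vec K p) = (\<Oplus>\<^bsub>P\<^esub>q \<in> {p}. basis_vec K p q \<odot>\<^bsub>P\<^esub> f q)"
    by (rule linear_extension_superset) (use assms in \<open>auto simp: basis_vec_def\<close>)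
  also have "\<dots> = f p"
    using assms(2) by (simp add: basis_vec_def)
  finally show ?thesis .
qed

lemma linear_extension_linear:
  assumes "module K P" "f \<in> X \<rightarrow> carrier P"
  shows "linear_map K (free_module K X) P (linear_extension P K f)"
proof (rule linear_mapI)
  interpret P: module K P by fact
  let ?F = "free_module K X"
  interpret F: module K ?F by (rule module_free_module) (rule P.is_cring)
  let ?S = "\<lambda>u. {q. u q \<noteq> \<zero>\<^bsub>K\<^esub>}"
  have *: "linear_extension P K f w = (\<Oplus>\<^bsub>P\<^esub>q \<in> S. w q \<odot>\<^bsub>P\<^esub> f q)"
    if "w \<in> carrier ?F" "?S w \<subseteq> S" "S \<subseteq> X" "finite S" for w S
    by (rule linear_extension_superset)
      (use assms that in \<open>auto simp: free_module_carrier\<close>)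
  show "linear_extension P K f u \<in> carrier P" if "u \<in> carrier ?F" for u
    unfolding linear_extension_def
    using that assms by (intro P.finsum_closed) (auto simp: free_module_carrier)
  show "linear_extension P K f (u \<oplus>\<^bsub>?F\<^esub> v) = linear_extension P K f u \<oplus>\<^bsub>P\<^esub> linear_extension P K f v"
    if u: "u \<in> carrier ?F" and v: "v \<in> carrier ?F" for u v
  proof -
    let ?T = "?S u \<union> ?S v"
    have T: "finite ?T" "?T \<subseteq> X" using u v by (auto simp: free_module_carrier)
    have [simp]: "u q \<in> carrier K" "v q \<in> carrier K" for q
      using u v by (auto simp: free_module_carrier)
    have [simp]: "f q \<in> carrier P" if "q \<in> X" for q
      using assms(2) that by auto
    have "linear_extension P K f (u \<oplus>\<^bsub>?F\<^esub> v) = (\<Oplus>\<^bsub>P\<^esub>q \<in> ?T. (u \<oplus>\<^bsub>?F\<^esub> v) q \<odot>\<^bsub>P\<^esub> f q)"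
      by (rule *[OF F.a_closed[OF u v]]) (use T in auto)
    also have "\<dots> = (\<Oplus>\<^bsub>P\<^esub>q \<in> ?T. u q \<odot>\<^bsub>P\<^esub> f q \<oplus>\<^bsub>P\<^esub> v q \<odot>\<^bsub>P\<^esub> f q)"
      by (rule P.finsum_cong') (use T in \<open>auto simp: P.smult_l_distr\<close>)
    also have "\<dots> = (\<Oplus>\<^bsub>P\<^esub>q \<in> ?T. u q \<odot>\<^bsub>P\<^esub> f q) \<oplus>\<^bsub>P\<^esub> (\<Oplus>\<^bsub>P\<^esub>q \<in> ?T. v q \<odot>\<^bsub>P\<^esub> f q)"
      by (rule P.finsum_addf) (use T in auto)
    also have "\<dots> = linear_extension P K f u \<oplus>\<^bsub>P\<^esub> linear_extension P K f v"
      using *[OF u, of ?T] *[OF v, of ?T] T by simp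
    finally show ?thesis .
  qed
  show "linear_extension P K f (c \<odot>\<^bsub>?F\<^esub> u) = c \<odot>\<^bsub>P\<^esub> linear_extension P K f u"
    if c: "c \<in> carrier K" and u: "u \<in> carrier ?F" for c u
  proof -
    have T: "finite (?S u)" "?S u \<subseteq> X" using u by (auto simp: free_module_carrier)
    have [simp]: "u q \<in> carrier K" for q
      using u by (auto simp: free_module_carrier)
    have [simp]: "f q \<in> carrier P" if "q \<in> X" for q
      using assms(2) that by auto
    have "linear_extension P K f (c \<odot>\<^bsub>?F\<^esub> u) = (\<Oplus>\<^bsub>P\<^esub>q \<in> ?S u. (c \<odot>\<^bsub>?F\<^esub> u) q \<odot>\<^bsub>P\<^esub> f q)"
      by (rule *[OF F.smult_closed[OF c u]]) (use T c in auto)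
    also have "\<dots> = (\<Oplus>\<^bsub>P\<^esub>q \<in> ?S u. c \<odot>\<^bsub>P\<^esub> (u q \<odot>\<^bsub>P\<^esub> f q))"
      by (rule P.finsum_cong') (use T c in \<open>auto simp: P.smult_assoc1\<close>)
    also have "\<dots> = c \<odot>\<^bsub>P\<^esub> linear_extension P K f u"
      unfolding linear_extension_def
      by (rule P.finsum_smult_ldistr[symmetric]) (use T c in auto)
    finally show ?thesis .
  qed
qed

section \<open>Quotient modules\<close>

context module
begin

lemma submodule_Inter:
  assumes "\<A> \<noteq> {}" and H: "\<And>H. H \<in> \<A> \<Longrightarrow> submodule H R M"
  shows "submodule (\<Inter>\<A>) R M"
proof (rule submoduleI)
  show "\<Inter>\<A> \<subseteq> carrier M" using assms(1) submoduleE(1)[OF H] by blast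
  show "\<zero>\<^bsub>M\<^esub> \<in> \<Inter>\<A>"
    using subgroup.one_closed[OF submodule.axioms(1)[OF H]] by simp
qed (use submoduleE[OF H] in auto)

context
  fixes H
  assumes H: "submodule H R M"
begin

interpretation HS: abelian_subgroup H M
  using submodule.axioms(1)[OF H]
  by (intro abelian_subgroupI3 additive_subgroupI M.abelian_group_axioms)

lemma quotient_module_carrier:
  "carrier (quotient_module M H) = (\<lambda>x. H +>\<^bsub>M\<^esub> x) ` carrier M"
  by (auto simp: quotient_module_def A_RCOSETS_def')

lemma quotient_module_add:
  assumes "x \<in> carrier M" "y \<in> carrier M"
  shows "(H +>\<^bsub>M\<^esub> x) \<oplus>\<^bsub>quotient_module M H\<^esub> (H +>\<^bsub>M\<^esub> y) = H +>\<^bsub>M\<^esub> (x \<oplus>\<^bsub>M\<^esub> y)"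
  using HS.a_rcos_sum[OF assms] by (simp add: quotient_module_def)

lemma coset_eqI:
  assumes "x \<in> carrier M" "y \<in> carrier M" "x \<ominus>\<^bsub>M\<^esub> y \<in> H"
  shows "H +>\<^bsub>M\<^esub> x = H +>\<^bsub>M\<^esub> y"
  using HS.a_rcos_module_rev[of y x] HS.a_repr_independence'[of x y] assms
  by (simp add: a_minus_def)

lemma coset_self: "x \<in> carrier M \<Longrightarrow> x \<in> H +>\<^bsub>M\<^esub> x"
  by (rule HS.a_rcos_self)

text \<open>The scalar action on a coset is a union over all its representatives \<open>u\<close>.
  Since \<open>H\<close> is stable under scalars, c(u - x) stays in \<open>H\<close>, so all members
  of the union coincide; the union is not empty because \<open>x\<close> lies in its own
  coset.\<close>

lemma quotient_module_smult:
  assumes c: "c \<in> carrier R" and x: "x \<in> carrier M"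
  shows "c \<odot>\<^bsub>quotient_module M H\<^esub> (H +>\<^bsub>M\<^esub> x) = H +>\<^bsub>M\<^esub> (c \<odot>\<^bsub>M\<^esub> x)"
proof -
  have "H +>\<^bsub>M\<^esub> (c \<odot>\<^bsub>M\<^esub> u) = H +>\<^bsub>M\<^esub> (c \<odot>\<^bsub>M\<^esub> x)" if u: "u \<in> H +>\<^bsub>M\<^esub> x" for u
  proof (rule coset_eqI)
    have u': "u \<in> carrier M" by (rule HS.a_elemrcos_carrier[OF x u])
    then show "c \<odot>\<^bsub>M\<^esub> u \<in> carrier M" "c \<odot>\<^bsub>M\<^esub> x \<in> carrier M" using c x by auto
    have "c \<odot>\<^bsub>M\<^esub> (u \<oplus>\<^bsub>M\<^esub> \<ominus>\<^bsub>M\<^esub> x) \<in> H"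
      using HS.a_rcos_module_imp[OF x u] submoduleE(4)[OF H c] by simp
    then show "c \<odot>\<^bsub>M\<^esub> u \<ominus>\<^bsub>M\<^esub> c \<odot>\<^bsub>M\<^esub> x \<in> H"
      using c x u' by (simp add: a_minus_def smult_r_distr smult_r_minus)
  qed
  then have "(\<Union>u \<in> H +>\<^bsub>M\<^esub> x. H +>\<^bsub>M\<^esub> (c \<odot>\<^bsub>M\<^esub> u)) = (\<Union>u \<in> H +>\<^bsub>M\<^esub> x. H +>\<^bsub>M\<^esub> (c \<odot>\<^bsub>M\<^esub> x))"
    by (rule SUP_cong[OF refl])
  also have "\<dots> = H +>\<^bsub>M\<^esub> (c \<odot>\<^bsub>M\<^esub> x)"
    using coset_self[OF x] by (intro cSUP_const) blast
  finally show ?thesis by (simp only: quotient_module_def module.simps)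
qed

lemma module_quotient_module: "module R (quotient_module M H)"
proof (rule moduleI)
  have zero: "zero (quotient_module M H) = H +>\<^bsub>M\<^esub> \<zero>\<^bsub>M\<^esub>"
    using HS.a_subset by (simp add: quotient_module_def)
  show "abelian_group (quotient_module M H)"
  proof (rule abelian_groupI)
    fix X assume "X \<in> carrier (quotient_module M H)"
    then obtain x where x: "x \<in> carrier M" "X = H +>\<^bsub>M\<^esub> x"
      by (auto simp: quotient_module_carrier)
    then show "\<exists>Y \<in> carrier (quotient_module M H).
        Y \<oplus>\<^bsub>quotient_module M H\<^esub> X = \<zero>\<^bsub>quotient_module M H\<^esub>"
      by (intro bexI[of _ "H +>\<^bsub>M\<^esub> (\<ominus>\<^bsub>M\<^esub> x)"])
        (auto simp: quotient_module_carrier quotient_module_add zero M.l_neg)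
  qed (auto simp: quotient_module_carrier quotient_module_add zero M.a_ac)
qed (auto simp: quotient_module_carrier quotient_module_add quotient_module_smult is_cring
      smult_l_distr smult_r_distr smult_assoc1)

lemma linear_map_coset: "linear_map R M (quotient_module M H) (\<lambda>x. H +>\<^bsub>M\<^esub> x)"
  by (rule linear_mapI)
    (auto simp: quotient_module_carrier quotient_module_add quotient_module_smult)

end

end

section \<open>Tensor products\<close>

context
  fixes K :: "('k, 'r) ring_scheme"
    and M :: "('k, 'a, 'm) module_scheme" and N :: "('k, 'b, 'n) module_scheme"
  assumes M: "module K M" and N: "module K N"
begin

interpretation M: module K M by (rule M)
interpretation N: module K N by (rule N)

private abbreviation "F \<equiv> free_module K (carrier M \<times> carrier N)"
private abbreviation "H \<equiv> tensor_kernel K M N"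
private abbreviation "T \<equiv> tensor_module K M N"

interpretation F: module K F by (rule module_free_module) (rule M.is_cring)

lemma basis_vec_pair_in_carrier:
  "x \<in> carrier M \<Longrightarrow> y \<in> carrier N \<Longrightarrow> basis_vec K (x, y) \<in> carrier F"
  by (rule basis_vec_in_carrier[OF M.is_cring]) auto

lemma tensor_relations_subset: "tensor_relations K M N \<subseteq> carrier F"
  unfolding tensor_relations_def Let_def
  by (auto simp del: free_module_sel
      intro!: F.minus_closed F.a_closed F.smult_closed basis_vec_pair_in_carrier)

lemma submodule_tensor_kernel: "submodule H K F"
proof -
  \<comment> \<open>The whole free module is a member of the family intersected in
    \<open>tensor_kernel\<close>, so that intersection is taken over a non-empty family.\<close>
  have "submodule (carrier F) K F" by (rule F.carrier_is_submodule)
  then show ?thesis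
    unfolding tensor_kernel_def using tensor_relations_subset by (intro F.submodule_Inter) blast+
qed

lemma tensor_relations_subset_kernel: "tensor_relations K M N \<subseteq> H"
  unfolding tensor_kernel_def by blast

lemma module_tensor_module: "module K T"
  unfolding tensor_module_def by (rule F.module_quotient_module[OF submodule_tensor_kernel])

lemma linear_map_tensor_coset: "linear_map K F T (\<lambda>u. H +>\<^bsub>F\<^esub> u)"
  unfolding tensor_module_def by (rule F.linear_map_coset[OF submodule_tensor_kernel])

lemma tensor_module_cases:
  assumes "t \<in> carrier T"
  obtains u where "u \<in> carrier F" "t = H +>\<^bsub>F\<^esub> u"
  using assms unfolding tensor_module_def F.quotient_module_carrier[OF submodule_tensor_kernel]
  by auto

text \<open>The four families in \<open>tensor_relations\<close> are the four identities of
  bilinearity, written as differences that the quotient kills.\<close>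

lemma tensor_bilinear: "bilinear_map K M N T (tensor K M N)"
proof -
  note coset = linear_mapD[OF linear_map_tensor_coset]
  note eq = F.coset_eqI[OF submodule_tensor_kernel _ _ subsetD[OF tensor_relations_subset_kernel]]
  note e = basis_vec_pair_in_carrier
  have "tensor K M N (x \<oplus>\<^bsub>M\<^esub> x') y = tensor K M N x y \<oplus>\<^bsub>T\<^esub> tensor K M N x' y"
    if "x \<in> carrier M" "x' \<in> carrier M" "y \<in> carrier N" for x x' y
  proof -
    have "H +>\<^bsub>F\<^esub> basis_vec K (x \<oplus>\<^bsub>M\<^esub> x', y) = H +>\<^bsub>F\<^esub> (basis_vec K (x, y) \<oplus>\<^bsub>F\<^esub> basis_vec K (x', y))"
      by (rule eq) (use that in \<open>auto simp del: free_module_sel intro!: e F.a_closed F.smult_closed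
          simp: tensor_relations_def Let_def\<close>)
    then show ?thesis
      unfolding tensor_def using that coset(2) e by simp
  qed
  moreover have "tensor K M N x (y \<oplus>\<^bsub>N\<^esub> y') = tensor K M N x y \<oplus>\<^bsub>T\<^esub> tensor K M N x y'"
    if "x \<in> carrier M" "y \<in> carrier N" "y' \<in> carrier N" for x y y'
  proof -
    have "H +>\<^bsub>F\<^esub> basis_vec K (x, y \<oplus>\<^bsub>N\<^esub> y') = H +>\<^bsub>F\<^esub> (basis_vec K (x, y) \<oplus>\<^bsub>F\<^esub> basis_vec K (x, y'))"
      by (rule eq) (use that in \<open>auto simp del: free_module_sel intro!: e F.a_closed F.smult_closed
          simp: tensor_relations_def Let_def\<close>)
    then show ?thesis
      unfolding tensor_def using that coset(2) e by simp
  qed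
  moreover have "tensor K M N (c \<odot>\<^bsub>M\<^esub> x) y = c \<odot>\<^bsub>T\<^esub> tensor K M N x y"
    if "c \<in> carrier K" "x \<in> carrier M" "y \<in> carrier N" for c x y
  proof -
    have "H +>\<^bsub>F\<^esub> basis_vec K (c \<odot>\<^bsub>M\<^esub> x, y) = H +>\<^bsub>F\<^esub> (c \<odot>\<^bsub>F\<^esub> basis_vec K (x, y))"
      by (rule eq) (use that in \<open>auto simp del: free_module_sel intro!: e F.a_closed F.smult_closed
          simp: tensor_relations_def Let_def\<close>)
    then show ?thesis
      unfolding tensor_def using that coset(3) e by simp
  qed
  moreover have "tensor K M N x (c \<odot>\<^bsub>N\<^esub> y) = c \<odot>\<^bsub>T\<^esub> tensor K M N x y"
    if "c \<in> carrier K" "x \<in> carrier M" "y \<in> carrier N" for c x y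
  proof -
    have "H +>\<^bsub>F\<^esub> basis_vec K (x, c \<odot>\<^bsub>N\<^esub> y) = H +>\<^bsub>F\<^esub> (c \<odot>\<^bsub>F\<^esub> basis_vec K (x, y))"
      by (rule eq) (use that in \<open>auto simp del: free_module_sel intro!: e F.a_closed F.smult_closed
          simp: tensor_relations_def Let_def\<close>)
    then show ?thesis
      unfolding tensor_def using that coset(3) e by simp
  qed
  moreover have "tensor K M N x y \<in> carrier T" if "x \<in> carrier M" "y \<in> carrier N" for x y
    unfolding tensor_def using coset(1) e that by simp
  ultimately show ?thesis
    unfolding bilinear_map_def by (auto intro!: linear_mapI)
qed

section \<open>The universal property of the tensor product\<close>

private abbreviation "ext P f \<equiv> linear_extension P K (\<lambda>q. f (fst q) (snd q))"

lemma linear_extension_bilinear: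
  assumes P: "module K P" and f: "bilinear_map K M N P f"
  shows "linear_map K F P (ext P f)"
  using bilinear_mapD(3)[OF f] by (intro linear_extension_linear P) auto

lemma linear_extension_basis_vec_pair:
  assumes P: "module K P" and f: "bilinear_map K M N P f" "x \<in> carrier M" "y \<in> carrier N"
  shows "ext P f (basis_vec K (x, y)) = f x y"
  using linear_extension_basis_vec[OF P, of "\<lambda>q. f (fst q) (snd q)" "(x, y)"]
    bilinear_mapD(3)[OF f] by simp

text \<open>By minimality of \<open>tensor_kernel\<close> it is enough that the linear extension
  vanishes on the generating relations, its kernel being a submodule.\<close>

lemma tensor_kernel_subset_kernel:
  assumes P: "module K P" and f: "bilinear_map K M N P f"
  shows "H \<subseteq> {u \<in> carrier F. ext P f u = \<zero>\<^bsub>P\<^esub>}"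
proof -
  interpret P: module K P by (rule P)
  note L = linear_extension_bilinear[OF P f]
  note Lb = linear_extension_basis_vec_pair[OF P f]
  have minus: "ext P f (u \<ominus>\<^bsub>F\<^esub> v) = \<zero>\<^bsub>P\<^esub>"
    if "u \<in> carrier F" "v \<in> carrier F" "ext P f u = ext P f v" for u v
    using that linear_mapD(1)[OF L, of v]
    unfolding a_minus_def
    by (subst linear_mapD(2)[OF L])
      (auto simp: linear_map_uminus[OF F.module_axioms P L] P.r_neg simp del: free_module_sel)
  have "tensor_relations K M N \<subseteq> {u \<in> carrier F. ext P f u = \<zero>\<^bsub>P\<^esub>}"
  proof
    fix r assume r: "r \<in> tensor_relations K M N"
    note e = basis_vec_pair_in_carrier
    note simps = linear_mapD(2,3)[OF L] Lb e F.a_closed F.smult_closed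
      linear_mapD(2,3)[OF bilinear_mapD(1)[OF f]] linear_mapD(2,3)[OF bilinear_mapD(2)[OF f]]
    \<comment> \<open>Every relation is a difference; \<open>minus\<close> turns vanishing into
      equality of two images, and that equality is one of the bilinearity laws of
      \<open>f\<close>.\<close>
    have "ext P f r = \<zero>\<^bsub>P\<^esub>"
      using r unfolding tensor_relations_def Let_def
      by (elim UnE CollectE exE conjE; hypsubst; intro minus; simp only: simps M.a_closed N.a_closed
          M.smult_closed N.smult_closed)
    then show "r \<in> {u \<in> carrier F. ext P f u = \<zero>\<^bsub>P\<^esub>}"
      using r tensor_relations_subset by blast
  qed
  then show ?thesis
    unfolding tensor_kernel_def
    using linear_map_kernel_submodule[OF F.module_axioms P L] by blast
qed

text \<open>Justifies the definite description in \<open>tensor_lift\<close>: two representatives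
  differ by an element of the kernel, where the sum is zero, so all of them yield the same
  value.\<close>

lemma tensor_lift_coset:
  assumes P: "module K P" and f: "bilinear_map K M N P f" and u: "u \<in> carrier F"
  shows "tensor_lift P K f (H +>\<^bsub>F\<^esub> u) = ext P f u"
proof -
  interpret P: module K P by (rule P)
  note L = linear_extension_bilinear[OF P f]
  have "ext P f v = ext P f u" if v: "v \<in> H +>\<^bsub>F\<^esub> u" for v
  proof -
    obtain h where h: "h \<in> H" "v = h \<oplus>\<^bsub>F\<^esub> u"
      using v unfolding a_r_coset_def' by blast
    then have "h \<in> carrier F" "ext P f h = \<zero>\<^bsub>P\<^esub>"
      using tensor_kernel_subset_kernel[OF P f] by blast+
    then show ?thesis
      using linear_mapD(1)[OF L u] u unfolding h(2) by (subst linear_mapD(2)[OF L]) auto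
  qed
  moreover have "u \<in> H +>\<^bsub>F\<^esub> u"
    by (rule F.coset_self[OF submodule_tensor_kernel u])
  ultimately show ?thesis
    unfolding tensor_lift_def linear_extension_def[symmetric] by (intro the_equality) blast+
qed

lemma tensor_lift_linear:
  assumes P: "module K P" and f: "bilinear_map K M N P f"
  shows "linear_map K T P (tensor_lift P K f)"
proof (rule linear_mapI)
  note L = linear_mapD[OF linear_extension_bilinear[OF P f]]
  note coset = linear_mapD[OF linear_map_tensor_coset]
  fix t assume t: "t \<in> carrier T"
  then obtain u where u: "u \<in> carrier F" "t = H +>\<^bsub>F\<^esub> u" by (rule tensor_module_cases)
  show "tensor_lift P K f t \<in> carrier P"
    using u L(1) by (simp add: tensor_lift_coset[OF P f])
  show "tensor_lift P K f (c \<odot>\<^bsub>T\<^esub> t) = c \<odot>\<^bsub>P\<^esub> tensor_lift P K f t" if "c \<in> carrier K" for c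
    using u that L(3) coset(3)[symmetric]
    by (simp add: tensor_lift_coset[OF P f] F.smult_closed[OF that] del: free_module_sel)
  fix t' assume t': "t' \<in> carrier T"
  then obtain v where v: "v \<in> carrier F" "t' = H +>\<^bsub>F\<^esub> v" by (rule tensor_module_cases)
  show "tensor_lift P K f (t \<oplus>\<^bsub>T\<^esub> t') = tensor_lift P K f t \<oplus>\<^bsub>P\<^esub> tensor_lift P K f t'"
    using u v L(2) coset(2)[symmetric]
    by (simp add: tensor_lift_coset[OF P f] del: free_module_sel)
qed

lemma tensor_lift_tensor:
  assumes "module K P" "bilinear_map K M N P f" "x \<in> carrier M" "y \<in> carrier N"
  shows "tensor_lift P K f (tensor K M N x y) = f x y"
  unfolding tensor_def
  using assms by (simp add: tensor_lift_coset linear_extension_basis_vec_pair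
      basis_vec_pair_in_carrier)

text \<open>Pure tensors generate: pulled back along the coset map, both maps are linear on the free
  module and agree on basis vectors. This uniqueness half yields all later identities between
  lifts.\<close>

lemma linear_map_tensor_eq:
  assumes P: "module K P" and f: "linear_map K T P f" and g: "linear_map K T P g"
    and eq: "\<And>x y. x \<in> carrier M \<Longrightarrow> y \<in> carrier N \<Longrightarrow> f (tensor K M N x y) = g (tensor K M N x y)"
    and t: "t \<in> carrier T"
  shows "f t = g t"
proof -
  obtain u where u: "u \<in> carrier F" "t = H +>\<^bsub>F\<^esub> u" using t by (rule tensor_module_cases)
  have "f (H +>\<^bsub>F\<^esub> u) = g (H +>\<^bsub>F\<^esub> u)"
    by (rule linear_map_free_module_eq[OF P linear_map_compose[OF linear_map_tensor_coset f]
          linear_map_compose[OF linear_map_tensor_coset g] _ u(1)])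
      (use eq in \<open>auto simp: tensor_def\<close>)
  then show ?thesis by (simp add: u)
qed

lemma tensor_lift_compose:
  assumes P: "module K P" and Q: "module K Q" and f: "bilinear_map K M N P f"
    and g: "linear_map K P Q g" and t: "t \<in> carrier T"
  shows "g (tensor_lift P K f t) = tensor_lift Q K (\<lambda>x y. g (f x y)) t"
  by (rule linear_map_tensor_eq[OF Q linear_map_compose[OF tensor_lift_linear[OF P f] g]
        tensor_lift_linear[OF Q bilinear_map_compose[OF f g]] _ t])
    (simp add: tensor_lift_tensor[OF P f] tensor_lift_tensor[OF Q bilinear_map_compose[OF f g]])

lemma tensor_lift_cong:
  assumes P: "module K P" and f: "bilinear_map K M N P f"
    and eq: "\<And>x y. x \<in> carrier M \<Longrightarrow> y \<in> carrier N \<Longrightarrow> f x y = g x y"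
    and t: "t \<in> carrier T"
  shows "tensor_lift P K f t = tensor_lift P K g t"
proof -
  have g: "bilinear_map K M N P g"
    by (rule iffD1[OF bilinear_map_cong[OF M N eq] f])
  show ?thesis
    by (rule linear_map_tensor_eq[OF P tensor_lift_linear[OF P f] tensor_lift_linear[OF P g] _ t])
      (simp add: tensor_lift_tensor[OF P f] tensor_lift_tensor[OF P g] eq)
qed

text \<open>Applied to \<Delta>(a), this is the tautology that the sum of \<open>a1\<close>
  \<otimes> \<open>a2\<close> is \<Delta>(a), which makes the identity a coalgebra morphism.\<close>

lemma tensor_lift_tensor_id:
  assumes t: "t \<in> carrier T"
  shows "tensor_lift T K (tensor K M N) t = t"
  by (rule linear_map_tensor_eq[OF module_tensor_module
        tensor_lift_linear[OF module_tensor_module tensor_bilinear]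
        linear_map_id[OF module_tensor_module] _ t])
    (simp add: tensor_lift_tensor[OF module_tensor_module tensor_bilinear])

end

section \<open>Conjugation racks of generalized digroups\<close>

lemma HaloD:
  assumes "e \<in> Halo D"
  shows "e \<in> carrier D" "x \<in> carrier D \<Longrightarrow> x \<stileturn>\<^sub>D\<^bsub>D\<^esub> e = x" "x \<in> carrier D \<Longrightarrow> e \<turnstile>\<^sub>D\<^bsub>D\<^esub> x = x"
  using assms by (auto simp: Halo_def)

context generalized_digroup
begin

lemma one_sided_inverse_closed: "one_sided_inverse D x y \<Longrightarrow> y \<in> carrier D"
  by (simp add: one_sided_inverse_def)

lemma one_sided_inverse_ex:
  assumes "x \<in> carrier D"
  obtains y where "one_sided_inverse D x y"
  using assms Halo_nonempty right_inverse_ex by (fastforce simp: one_sided_inverse_def)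

text \<open>
  Left translations by \<open>\<turnstile>\<close> and right translations by \<open>\<stileturn>\<close> are actions of a group, namely of \<open>D\<close> with
  all bar-units identified; there every one-sided inverse becomes the inverse.
\<close>

lemma right_inverse_cancel:
  assumes x: "x \<in> carrier D" and y: "y \<in> carrier D" "x \<turnstile>\<^sub>D y \<in> Halo D" and w: "w \<in> carrier D"
  shows "x \<turnstile>\<^sub>D (y \<turnstile>\<^sub>D w) = w" "(w \<stileturn>\<^sub>D x) \<stileturn>\<^sub>D y = w"
  using HaloD(2,3)[OF y(2)] dleft_assoc[of x y w] dright_assoc[of w x y] bar_right[of w x y] x y w
  by simp_all

lemma left_inverse_cancel:
  assumes x: "x \<in> carrier D" and y: "y \<in> carrier D" "y \<stileturn>\<^sub>D x \<in> Halo D" and w: "w \<in> carrier D"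
  shows "y \<turnstile>\<^sub>D (x \<turnstile>\<^sub>D w) = w" "(w \<stileturn>\<^sub>D y) \<stileturn>\<^sub>D x = w"
  using HaloD(2,3)[OF y(2)] dleft_assoc[of y x w] dright_assoc[of w y x] bar_left[of y x w] x y w
  by simp_all

text \<open>A one-sided inverse cancels on both sides because its action coincides with that of a
  genuine right inverse \<open>r\<close> and of a genuine left inverse \<open>l\<close>, although
  \<open>y\<close>, \<open>r\<close> and \<open>l\<close> may be distinct elements.\<close>

lemma one_sided_inverse_cancel:
  assumes x: "x \<in> carrier D" and y: "one_sided_inverse D x y" and w: "w \<in> carrier D"
  shows "x \<turnstile>\<^sub>D (y \<turnstile>\<^sub>D w) = w" "y \<turnstile>\<^sub>D (x \<turnstile>\<^sub>D w) = w"
    "(w \<stileturn>\<^sub>D x) \<stileturn>\<^sub>D y = w" "(w \<stileturn>\<^sub>D y) \<stileturn>\<^sub>D x = w"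
proof -
  obtain e where e: "e \<in> Halo D" using Halo_nonempty by blast
  obtain r where r: "r \<in> carrier D" "x \<turnstile>\<^sub>D r \<in> Halo D" using right_inverse_ex[OF e x] e by auto
  obtain l where l: "l \<in> carrier D" "l \<stileturn>\<^sub>D x \<in> Halo D" using left_inverse_ex[OF e x] e by auto
  note R = right_inverse_cancel[OF x r] and L = left_inverse_cancel[OF x l]
  note closed = dleft_closed dright_closed
  \<comment> \<open>The group argument that left and right inverses agree, carried out on actions:
    \<open>l\<close> applied to \<open>v\<close>, with \<open>v\<close> rewritten as
    \<open>x\<close> applied to (\<open>r\<close> applied to \<open>v\<close>), leaves
    \<open>r\<close> applied to \<open>v\<close>. The given \<open>y\<close> is then compared with
    \<open>l\<close> or with \<open>r\<close>, according to the side on which it inverts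
    \<open>x\<close>.\<close>
  have lr: "l \<turnstile>\<^sub>D v = r \<turnstile>\<^sub>D v" "v \<stileturn>\<^sub>D l = v \<stileturn>\<^sub>D r" if "v \<in> carrier D" for v
    using L(1)[of "r \<turnstile>\<^sub>D v"] R(1)[of v] R(2)[of "v \<stileturn>\<^sub>D l"] L(2)[of v] that l(1) r(1) closed
    by simp_all
  have yc: "y \<in> carrier D" using y by (rule one_sided_inverse_closed)
  have "y \<turnstile>\<^sub>D v = r \<turnstile>\<^sub>D v \<and> v \<stileturn>\<^sub>D y = v \<stileturn>\<^sub>D r" if v: "v \<in> carrier D" for v
  proof (cases "x \<turnstile>\<^sub>D y \<in> Halo D")
    case True
    note Y = right_inverse_cancel[OF x yc True]
    show ?thesis
      using L(1)[of "y \<turnstile>\<^sub>D v"] Y(1)[of v] Y(2)[of "v \<stileturn>\<^sub>D l"] L(2)[of v] lr v l(1) yc closed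
      by metis
  next
    case False
    then have "y \<stileturn>\<^sub>D x \<in> Halo D" using y by (simp add: one_sided_inverse_def)
    note Y = left_inverse_cancel[OF x yc this]
    show ?thesis
      using Y(1)[of "r \<turnstile>\<^sub>D v"] R(1)[of v] R(2)[of "v \<stileturn>\<^sub>D y"] Y(2)[of v] v r(1) yc closed
      by simp
  qed
  then show "x \<turnstile>\<^sub>D (y \<turnstile>\<^sub>D w) = w" "y \<turnstile>\<^sub>D (x \<turnstile>\<^sub>D w) = w"
    "(w \<stileturn>\<^sub>D x) \<stileturn>\<^sub>D y = w" "(w \<stileturn>\<^sub>D y) \<stileturn>\<^sub>D x = w"
    using R L lr x w closed by metis+
qed

end

lemma Conj_sel [simp]:
  "carrier (Conj D) = carrier D"
  "rack_op (Conj D) x y = (x \<turnstile>\<^sub>D\<^bsub>D\<^esub> y) \<stileturn>\<^sub>D\<^bsub>D\<^esub> (SOME z. one_sided_inverse D x z)"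
  by (simp_all add: Conj_def)

text \<open>Eliminates the choice operator. With z' the chosen inverse, inserting a cancelling pair
  gives \<open>w \<stileturn> z = ((w \<stileturn> z) \<stileturn> x) \<stileturn> z' = w
  \<stileturn> z'\<close>.\<close>

lemma Conj_op_eq:
  assumes "generalized_digroup D" and x: "x \<in> carrier D" and y: "y \<in> carrier D"
    and z: "one_sided_inverse D x z"
  shows "x \<triangleright>\<^bsub>Conj D\<^esub> y = (x \<turnstile>\<^sub>D\<^bsub>D\<^esub> y) \<stileturn>\<^sub>D\<^bsub>D\<^esub> z"
proof -
  interpret generalized_digroup D by fact
  let ?z = "SOME z. one_sided_inverse D x z"
  have z': "one_sided_inverse D x ?z" using z by (rule someI)
  have "w \<stileturn>\<^sub>D\<^bsub>D\<^esub> ?z = w \<stileturn>\<^sub>D\<^bsub>D\<^esub> z" if w: "w \<in> carrier D" for w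
    using one_sided_inverse_cancel(4)[OF x z w]
      one_sided_inverse_cancel(3)[OF x z', of "w \<stileturn>\<^sub>D\<^bsub>D\<^esub> z"]
      w dright_closed one_sided_inverse_closed[OF z] by simp
  then show ?thesis using dleft_closed[OF x y] by simp
qed

lemma is_rack_Conj:
  assumes "generalized_digroup D"
  shows "is_rack (Conj D)"
proof -
  interpret generalized_digroup D by fact
  define i where "i x = (SOME z. one_sided_inverse D x z)" for x
  have i: "one_sided_inverse D x (i x)" if "x \<in> carrier D" for x
    unfolding i_def using one_sided_inverse_ex[OF that] by (metis someI)
  have ic: "i x \<in> carrier D" if "x \<in> carrier D" for x
    using i[OF that] by (rule one_sided_inverse_closed)
  have op: "rack_op (Conj D) x y = (x \<turnstile>\<^sub>D\<^bsub>D\<^esub> y) \<stileturn>\<^sub>D\<^bsub>D\<^esub> i x" for x y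
    by (simp add: i_def)
  note closed = dleft_closed dright_closed ic
  note cancel = one_sided_inverse_cancel[OF _ i]
  show ?thesis
  proof
    show "carrier (Conj D) \<noteq> {}" using nonempty by simp
  next
    fix x assume "x \<in> carrier (Conj D)"
    then have x: "x \<in> carrier D" by simp
    \<comment> \<open>The inverse translation is conjugation by \<open>i x\<close>, with
      \<open>x\<close> itself in the role of the inverse of \<open>i x\<close>;
      \<open>inner_assoc\<close> lets left and right actions commute, so the pairs cancel
      separately.\<close>
    show "bij_betw (\<lambda>y. x \<triangleright>\<^bsub>Conj D\<^esub> y) (carrier (Conj D)) (carrier (Conj D))"
      by (rule bij_betwI[where g = "\<lambda>y. (i x \<turnstile>\<^sub>D\<^bsub>D\<^esub> y) \<stileturn>\<^sub>D\<^bsub>D\<^esub> x"])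
        (use x in \<open>auto simp: op closed cancel inner_assoc simp del: Conj_sel(2)\<close>)
  next
    fix x y z
    assume "x \<in> carrier (Conj D)" "y \<in> carrier (Conj D)" "z \<in> carrier (Conj D)"
    then have c: "x \<in> carrier D" "y \<in> carrier D" "z \<in> carrier D" by simp_all
    define xy where "xy = (x \<turnstile>\<^sub>D\<^bsub>D\<^esub> y) \<stileturn>\<^sub>D\<^bsub>D\<^esub> i x"
    have xy: "xy \<in> carrier D" unfolding xy_def using c closed by simp
    \<comment> \<open>\<open>xy\<close> acts from the left as the product of \<open>x\<close>,
      \<open>y\<close> and \<open>i x\<close>; \<open>bar_left\<close> makes the kind of the inner
      products irrelevant there. The fact \<open>right\<close> is its mirror image.\<close>
    have left: "xy \<turnstile>\<^sub>D\<^bsub>D\<^esub> w = x \<turnstile>\<^sub>D\<^bsub>D\<^esub> (y \<turnstile>\<^sub>D\<^bsub>D\<^esub> (i x \<turnstile>\<^sub>D\<^bsub>D\<^esub> w))" if w: "w \<in> carrier D" for w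
      unfolding xy_def using c w closed by (simp add: bar_left[symmetric] dleft_assoc)
    have right: "w \<stileturn>\<^sub>D\<^bsub>D\<^esub> xy = ((w \<stileturn>\<^sub>D\<^bsub>D\<^esub> x) \<stileturn>\<^sub>D\<^bsub>D\<^esub> y) \<stileturn>\<^sub>D\<^bsub>D\<^esub> i x" if w: "w \<in> carrier D" for w
      unfolding xy_def using c w closed dright_assoc[of w "x \<turnstile>\<^sub>D\<^bsub>D\<^esub> y" "i x"]
        bar_right[of w x y] dright_assoc[of w x y] by simp
    \<comment> \<open>\<open>i xy\<close> is an arbitrary choice, known only through cancellation.
      The expected value, the right action of x y^{-1} x^{-1}, is confirmed by multiplying it by
      \<open>xy\<close> and getting back \<open>w\<close>.\<close>
    have inv: "w \<stileturn>\<^sub>D\<^bsub>D\<^esub> i xy = ((w \<stileturn>\<^sub>D\<^bsub>D\<^esub> x) \<stileturn>\<^sub>D\<^bsub>D\<^esub> i y) \<stileturn>\<^sub>D\<^bsub>D\<^esub> i x" if w: "w \<in> carrier D" for w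
    proof -
      have "(((w \<stileturn>\<^sub>D\<^bsub>D\<^esub> x) \<stileturn>\<^sub>D\<^bsub>D\<^esub> i y) \<stileturn>\<^sub>D\<^bsub>D\<^esub> i x) \<stileturn>\<^sub>D\<^bsub>D\<^esub> xy = w"
        using c w closed by (simp add: right cancel)
      then show ?thesis
        using cancel(3)[OF xy xy, of "((w \<stileturn>\<^sub>D\<^bsub>D\<^esub> x) \<stileturn>\<^sub>D\<^bsub>D\<^esub> i y) \<stileturn>\<^sub>D\<^bsub>D\<^esub> i x"] c w closed by simp
    qed
    \<comment> \<open>Once \<open>xy\<close> and \<open>i xy\<close> are replaced by their actions,
      \<open>i x\<close> meets \<open>x\<close> on either side of \<open>z\<close> and both pairs
      cancel.\<close>
    show "x \<triangleright>\<^bsub>Conj D\<^esub> (y \<triangleright>\<^bsub>Conj D\<^esub> z) = (x \<triangleright>\<^bsub>Conj D\<^esub> y) \<triangleright>\<^bsub>Conj D\<^esub> (x \<triangleright>\<^bsub>Conj D\<^esub> z)"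
      unfolding op xy_def[symmetric] using c xy closed
      by (simp add: left inv cancel inner_assoc[symmetric])
  qed
qed

text \<open>\<open>f\<close> need not match the choices made in \<open>D\<close> and
  \<open>E\<close>. It does carry a one-sided inverse to a one-sided inverse, because it preserves
  bar-units, and any one-sided inverse computes the product.\<close>

lemma gDig_morphism_Conj:
  assumes D: "generalized_digroup D" and E: "generalized_digroup E"
    and f: "f \<in> carrier D \<rightarrow> carrier E" "gDig_morphism D E f"
    and x: "x \<in> carrier D" and y: "y \<in> carrier D"
  shows "f (x \<triangleright>\<^bsub>Conj D\<^esub> y) = f x \<triangleright>\<^bsub>Conj E\<^esub> f y"
proof -
  interpret D: generalized_digroup D by (rule D)
  obtain z where z: "one_sided_inverse D x z" using D.one_sided_inverse_ex[OF x] .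
  have zc: "z \<in> carrier D" using z by (rule D.one_sided_inverse_closed)
  have "one_sided_inverse E (f x) (f z)"
    using z f x unfolding one_sided_inverse_def gDig_morphism_def by (metis funcset_mem)
  then have "f x \<triangleright>\<^bsub>Conj E\<^esub> f y = (f x \<turnstile>\<^sub>D\<^bsub>E\<^esub> f y) \<stileturn>\<^sub>D\<^bsub>E\<^esub> f z"
    using f x y by (intro Conj_op_eq[OF E]) auto
  also have "\<dots> = f (x \<triangleright>\<^bsub>Conj D\<^esub> y)"
    using f(2) x y zc D.dleft_closed unfolding Conj_op_eq[OF D x y z]
    by (simp add: gDig_morphism_def)
  finally show ?thesis by simp
qed

section \<open>The categories of digroups and racks, and the functors between them\<close>

lemma gDig_morphism_restrict:
  assumes "generalized_digroup D"
  shows "gDig_morphism D E (restrict f (carrier D)) \<longleftrightarrow> gDig_morphism D E f"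
proof -
  interpret generalized_digroup D by fact
  show ?thesis
    unfolding gDig_morphism_def using dleft_closed dright_closed HaloD(1)[of _ D] by simp
qed

lemma gDig_morphism_compose:
  assumes "generalized_digroup D" "f \<in> carrier D \<rightarrow> carrier E"
    and "gDig_morphism D E f" "gDig_morphism E F g"
  shows "gDig_morphism D F (compose (carrier D) g f)"
  using assms(2-4) unfolding compose_def gDig_morphism_restrict[OF assms(1)]
  by (simp add: gDig_morphism_def Pi_iff)

lemma gDig_morphism_id:
  assumes "generalized_digroup D"
  shows "gDig_morphism D D (\<lambda>x \<in> carrier D. x)"
  unfolding gDig_morphism_restrict[OF assms] by (simp add: gDig_morphism_def)

lemma category_gDig: "category gDig"
  unfolding gDig_def
  by (rule category_concrete_cat) (auto intro: gDig_morphism_id gDig_morphism_compose)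

lemma category_Rack: "category (Rack :: ('a rack, 'a \<Rightarrow> 'a) cat)"
  unfolding Rack_def
proof (rule category_concrete_cat)
  \<comment> \<open>Closure of a rack under its operation is contained in the bijectivity of left
    translations.\<close>
  have closed: "x \<triangleright>\<^bsub>X\<^esub> y \<in> carrier X" if "is_rack X" "x \<in> carrier X" "y \<in> carrier X"
    for X :: "'a rack" and x y
    using is_rack.left_translation_bij[OF that(1,2)] that(3) by (auto simp: bij_betw_def)
  fix X Y Z :: "'a rack" and f g
  show "\<forall>x \<in> carrier X. \<forall>y \<in> carrier X. (\<lambda>x \<in> carrier X. x) (x \<triangleright>\<^bsub>X\<^esub> y)
      = (\<lambda>x \<in> carrier X. x) x \<triangleright>\<^bsub>X\<^esub> (\<lambda>x \<in> carrier X. x) y" if "X \<in> {X. is_rack X}"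
    using that closed by simp
  assume "X \<in> {X. is_rack X}" "f \<in> carrier X \<rightarrow> carrier Y"
    "\<forall>x \<in> carrier X. \<forall>y \<in> carrier X. f (x \<triangleright>\<^bsub>X\<^esub> y) = f x \<triangleright>\<^bsub>Y\<^esub> f y"
    "\<forall>x \<in> carrier Y. \<forall>y \<in> carrier Y. g (x \<triangleright>\<^bsub>Y\<^esub> y) = g x \<triangleright>\<^bsub>Z\<^esub> g y"
  then show "\<forall>x \<in> carrier X. \<forall>y \<in> carrier X. compose (carrier X) g f (x \<triangleright>\<^bsub>X\<^esub> y)
      = compose (carrier X) g f x \<triangleright>\<^bsub>Z\<^esub> compose (carrier X) g f y"
    using closed by (simp add: compose_def Pi_iff)
qed

lemma category_Dig: "category (Dig :: ('a digroup, 'a \<Rightarrow> 'a) cat)"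
  unfolding Dig_def
proof (rule category_concrete_cat)
  fix D E F :: "'a digroup" and f g
  show "gDig_morphism D D (\<lambda>x \<in> carrier D. x) \<and> (\<lambda>x \<in> carrier D. x) (dunit D) = dunit D"
    if "D \<in> {D. is_digroup D}"
    using that HaloD(1)[OF is_digroup.dunit_bar_unit, of D]
    by (simp add: gDig_morphism_id is_digroup.axioms(1))
  assume "D \<in> {D. is_digroup D}" "f \<in> carrier D \<rightarrow> carrier E"
    "gDig_morphism D E f \<and> f (dunit D) = dunit E" "gDig_morphism E F g \<and> g (dunit E) = dunit F"
  then show "gDig_morphism D F (compose (carrier D) g f)
      \<and> compose (carrier D) g f (dunit D) = dunit F"
    using HaloD(1)[OF is_digroup.dunit_bar_unit, of D] gDig_morphism_compose[of D f E F g]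
    by (simp add: compose_def is_digroup.axioms(1))
qed

lemma truncate_sel [simp]:
  "carrier (gdigroup.truncate D) = carrier D"
  "dleft (gdigroup.truncate D) = dleft D"
  "dright (gdigroup.truncate D) = dright D"
  by (simp_all add: gdigroup.truncate_def)

lemma Halo_truncate [simp]: "Halo (gdigroup.truncate D) = Halo D"
  by (simp add: Halo_def)

lemma generalized_digroup_truncate:
  "generalized_digroup (gdigroup.truncate D) \<longleftrightarrow> generalized_digroup D"
  by (simp add: generalized_digroup_def)

lemma gDig_morphism_truncate:
  "gDig_morphism (gdigroup.truncate D) (gdigroup.truncate E) f \<longleftrightarrow> gDig_morphism D E f"
  by (simp add: gDig_morphism_def)

lemma one_sided_inverse_truncate:
  "one_sided_inverse (gdigroup.truncate D) x y \<longleftrightarrow> one_sided_inverse D x y"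
  by (simp add: one_sided_inverse_def)

lemma is_functor_Dig_inclusion: "is_functor Dig gDig Dig_inclusion"
  using category_Dig category_gDig unfolding Dig_def gDig_def
  by (rule is_functor_restrict)
    (auto simp: Dig_inclusion_def generalized_digroup_truncate gDig_morphism_truncate
      gDig_morphism_restrict is_digroup.axioms(1) PiE_restrict)

lemma is_functor_Conj: "is_functor (gDig :: ('a gdigroup, 'a \<Rightarrow> 'a) cat) Rack Conj_functor"
  using category_gDig category_Rack unfolding gDig_def Rack_def
proof (rule is_functor_restrict)
  fix D E :: "'a gdigroup" and f
  assume D: "D \<in> {D. generalized_digroup D}" and E: "E \<in> {D. generalized_digroup D}"
    and f: "f \<in> carrier D \<rightarrow> carrier E" "gDig_morphism D E f"
  have "x \<triangleright>\<^bsub>Conj D\<^esub> y \<in> carrier D" if "x \<in> carrier D" "y \<in> carrier D" for x y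
    using is_rack.left_translation_bij[OF is_rack_Conj, of D x] D that by (auto simp: bij_betw_def)
  then show "\<forall>x \<in> carrier (on_obj Conj_functor D). \<forall>y \<in> carrier (on_obj Conj_functor D).
      restrict f (carrier (on_obj Conj_functor D)) (x \<triangleright>\<^bsub>on_obj Conj_functor D\<^esub> y)
        = restrict f (carrier (on_obj Conj_functor D)) x \<triangleright>\<^bsub>on_obj Conj_functor E\<^esub>
          restrict f (carrier (on_obj Conj_functor D)) y"
    using gDig_morphism_Conj[OF _ _ f] D E by (simp add: Conj_functor_def del: Conj_sel(2))
qed (auto simp: Conj_functor_def is_rack_Conj PiE_restrict)

section \<open>Group-like elements\<close>

lemma grouplikesD:
  assumes "g \<in> grouplikes K C"
  shows "g \<in> carrier C" "comult C g = tensor K C C g g" "counit C g = \<one>\<^bsub>K\<^esub>"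
  using assms by (auto simp: grouplikes_def)

text \<open>\<Delta>(g) is a pure tensor, where the lift of a bilinear map returns the map
  itself.\<close>

lemma sweedler_grouplike:
  assumes "module K C" "module K P" "bilinear_map K C C P f" "g \<in> grouplikes K C"
  shows "sweedler P K C g f = f g g"
  using tensor_lift_tensor[OF assms(1,1,2,3)] grouplikesD[OF assms(4)]
  by (simp add: sweedler_def)

lemma coalgebra_morphism_grouplike:
  assumes C: "module K C" and D: "module K D"
    and f: "coalgebra_morphism K C D f" and g: "g \<in> grouplikes K C"
  shows "f g \<in> grouplikes K D"
proof -
  have lin: "linear_map K C D f" using f by (simp add: coalgebra_morphism_def)
  have "sweedler (tensor_square K D) K C g (\<lambda>a1 a2. tensor K D D (f a1) (f a2))
      = tensor K D D (f g) (f g)"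
    by (rule sweedler_grouplike[OF C module_tensor_module[OF D D]
          bilinear_map_precompose[OF tensor_bilinear[OF D D] lin lin] g])
  then show ?thesis
    using f grouplikesD[OF g] linear_mapD(1)[OF lin]
    by (simp add: coalgebra_morphism_def grouplikes_def)
qed

lemma coalgebra_product_grouplike:
  assumes C: "module K C" and p: "coalgebra_product K C p"
    and g: "g \<in> grouplikes K C" and h: "h \<in> grouplikes K C"
  shows "p g h \<in> grouplikes K C"
proof -
  interpret module K C by (rule C)
  let ?T = "tensor_square K C"
  have bil: "bilinear_map K C C C p" using p by (simp add: coalgebra_product_def)
  note T = module_tensor_module[OF C C] and t = tensor_bilinear[OF C C]
  have inner: "sweedler ?T K C h (\<lambda>b1 b2. tensor K C C (p a1 b1) (p a2 b2))
      = tensor K C C (p a1 h) (p a2 h)"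
    if "a1 \<in> carrier C" "a2 \<in> carrier C" for a1 a2
    by (rule sweedler_grouplike[OF C T bilinear_map_precompose[OF t] h])
      (use bilinear_mapD(1)[OF bil] that in auto)
  have hc: "h \<in> carrier C" by (rule grouplikesD(1)[OF h])
  have "bilinear_map K C C ?T (\<lambda>a1 a2. tensor K C C (p a1 h) (p a2 h))"
    by (rule bilinear_map_precompose[OF t]) (rule bilinear_mapD(2)[OF bil hc])+
  \<comment> \<open>Collapsing the outer sum needs its summand to be bilinear, but that summand is
    itself a Sweedler sum over \<open>h\<close>, with a closed form only for arguments in the
    carrier; hence the passage through \<open>bilinear_map_cong\<close>.\<close>
  then have "bilinear_map K C C ?T
      (\<lambda>a1 a2. sweedler ?T K C h (\<lambda>b1 b2. tensor K C C (p a1 b1) (p a2 b2)))"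
    using bilinear_map_cong[OF C C,
        where P = ?T and f = "\<lambda>a1 a2. tensor K C C (p a1 h) (p a2 h)"
          and g = "\<lambda>a1 a2. sweedler ?T K C h (\<lambda>b1 b2. tensor K C C (p a1 b1) (p a2 b2))"]
      inner by simp
  then have "sweedler ?T K C g
      (\<lambda>a1 a2. sweedler ?T K C h (\<lambda>b1 b2. tensor K C C (p a1 b1) (p a2 b2)))
      = tensor K C C (p g h) (p g h)"
    using grouplikesD(1)[OF g] by (simp add: sweedler_grouplike[OF C T _ g] inner)
  then show ?thesis
    using p grouplikesD[OF g] grouplikesD[OF h] bilinear_mapD(3)[OF bil]
    by (simp add: coalgebra_product_def grouplikes_def)
qed

section \<open>Identities and composites of coalgebra morphisms\<close>

lemma coalgebra_morphism_id:
  assumes "cocommutative_coalgebra K C"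
  shows "coalgebra_morphism K C C (\<lambda>x. x)"
proof -
  interpret cocommutative_coalgebra K C by fact
  note C = module_axioms
  show ?thesis
    using linear_map_id[OF C] tensor_lift_tensor_id[OF C C linear_mapD(1)[OF comult_linear]]
    by (simp add: coalgebra_morphism_def sweedler_def)
qed

text \<open>Lifting g \<otimes> g after f \<otimes> f is lifting gf \<otimes> gf: push the outer
  lift, which is linear, through the inner one and evaluate it on pure tensors.\<close>

lemma coalgebra_morphism_compose:
  assumes C: "cocommutative_coalgebra K C" and D: "cocommutative_coalgebra K D"
    and E: "cocommutative_coalgebra K E"
    and f: "coalgebra_morphism K C D f" and g: "coalgebra_morphism K D E g"
  shows "coalgebra_morphism K C E (\<lambda>x. g (f x))"
proof -
  interpret C: cocommutative_coalgebra K C by (rule C)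
  interpret D: cocommutative_coalgebra K D by (rule D)
  interpret E: cocommutative_coalgebra K E by (rule E)
  note C = C.module_axioms and D = D.module_axioms and E = E.module_axioms
  note TD = module_tensor_module[OF D D] and TE = module_tensor_module[OF E E]
  have lf: "linear_map K C D f" and lg: "linear_map K D E g"
    using f g by (simp_all add: coalgebra_morphism_def)
  define ff where "ff = (\<lambda>a1 a2. tensor K D D (f a1) (f a2))"
  define gg where "gg = (\<lambda>b1 b2. tensor K E E (g b1) (g b2))"
  have bf: "bilinear_map K C C (tensor_square K D) ff"
    unfolding ff_def by (rule bilinear_map_precompose[OF tensor_bilinear[OF D D] lf lf])
  have bg: "bilinear_map K D D (tensor_square K E) gg"
    unfolding gg_def by (rule bilinear_map_precompose[OF tensor_bilinear[OF E E] lg lg])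
  note lift = tensor_lift_linear[OF D D TE bg]
  have "comult E (g (f a))
      = sweedler (tensor_square K E) K C a (\<lambda>a1 a2. tensor K E E (g (f a1)) (g (f a2)))"
    if a: "a \<in> carrier C" for a
  proof -
    have \<Delta>: "comult C a \<in> carrier (tensor_square K C)"
      by (rule linear_mapD(1)[OF C.comult_linear a])
    have "comult E (g (f a)) = tensor_lift (tensor_square K E) K gg (comult D (f a))"
      using g linear_mapD(1)[OF lf a] by (simp add: coalgebra_morphism_def sweedler_def gg_def)
    also have "comult D (f a) = tensor_lift (tensor_square K D) K ff (comult C a)"
      using f a by (simp add: coalgebra_morphism_def sweedler_def ff_def)
    also have "tensor_lift (tensor_square K E) K gg \<dots>
        = tensor_lift (tensor_square K E) K
            (\<lambda>a1 a2. tensor_lift (tensor_square K E) K gg (ff a1 a2)) (comult C a)"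
      by (rule tensor_lift_compose[OF C C TD TE bf lift \<Delta>])
    also have "\<dots> = tensor_lift (tensor_square K E) K (\<lambda>a1 a2. gg (f a1) (f a2)) (comult C a)"
      by (rule tensor_lift_cong[OF C C TE bilinear_map_compose[OF bf lift] _ \<Delta>])
        (use linear_mapD(1)[OF lf] in \<open>simp add: ff_def tensor_lift_tensor[OF D D TE bg]\<close>)
    finally show ?thesis by (simp add: sweedler_def gg_def)
  qed
  then show ?thesis
    using f g linear_map_compose[OF lf lg] linear_mapD(1)[OF lf]
    by (simp add: coalgebra_morphism_def)
qed

text \<open>Needed because arrows are restricted to carriers: identities and composites are verified
  as plain functions and then restricted.\<close>

lemma coalgebra_morphism_cong:
  assumes C: "cocommutative_coalgebra K C" and D: "module K D"
    and f: "coalgebra_morphism K C D f" and eq: "\<And>x. x \<in> carrier C \<Longrightarrow> f x = g x"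
  shows "coalgebra_morphism K C D g"
proof -
  interpret C: cocommutative_coalgebra K C by (rule C)
  note C = C.module_axioms
  have lf: "linear_map K C D f" using f by (simp add: coalgebra_morphism_def)
  have "sweedler (tensor_square K D) K C a (\<lambda>a1 a2. tensor K D D (f a1) (f a2))
      = sweedler (tensor_square K D) K C a (\<lambda>a1 a2. tensor K D D (g a1) (g a2))"
    if a: "a \<in> carrier C" for a
    unfolding sweedler_def
    by (rule tensor_lift_cong[OF C C module_tensor_module[OF D D]
          bilinear_map_precompose[OF tensor_bilinear[OF D D] lf lf] _
          linear_mapD(1)[OF C.comult_linear a]]) (simp add: eq)
  moreover have "linear_map K C D g" by (rule iffD1[OF linear_map_cong[OF C eq] lf])
  ultimately show ?thesis
    using f eq by (simp add: coalgebra_morphism_def)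
qed

section \<open>Cocommutative Hopf dialgebras\<close>

context cocommutative_hopf_dialgebra
begin

lemma lprod_bilinear: "bilinear_map K A A A (lprod A)"
  using lprod_coalgebra by (simp add: coalgebra_product_def)

lemma rprod_bilinear: "bilinear_map K A A A (rprod A)"
  using rprod_coalgebra by (simp add: coalgebra_product_def)

lemma antipode_linear: "linear_map K A A (antipode A)"
  using antipode_morphism by (simp add: coalgebra_morphism_def)

lemmas lprod_closed = bilinear_mapD(3)[OF lprod_bilinear]
lemmas rprod_closed = bilinear_mapD(3)[OF rprod_bilinear]
lemmas antipode_closed = linear_mapD(1)[OF antipode_linear]

lemmas lprod_grouplike = coalgebra_product_grouplike[OF module_axioms lprod_coalgebra]
lemmas rprod_grouplike = coalgebra_product_grouplike[OF module_axioms rprod_coalgebra]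
lemmas antipode_grouplike =
  coalgebra_morphism_grouplike[OF module_axioms module_axioms antipode_morphism]

lemma antipode_right_grouplike:
  assumes g: "g \<in> grouplikes K A"
  shows "g \<turnstile> antipode A g = \<xi>"
proof -
  have "bilinear_map K A A A (\<lambda>a1 a2. a1 \<turnstile> antipode A a2)"
    by (rule bilinear_map_precompose[OF lprod_bilinear linear_map_id[OF module_axioms] antipode_linear])
  then show ?thesis
    using antipode_right[OF grouplikesD(1)[OF g]] grouplikesD[OF g] grouplikesD(1)[OF bar_unit_grouplike]
      sweedler_grouplike[OF module_axioms module_axioms _ g] by simp
qed

lemma antipode_left_grouplike:
  assumes g: "g \<in> grouplikes K A"
  shows "antipode A g \<stileturn> g = \<xi>"
proof -
  have "bilinear_map K A A A (\<lambda>a1 a2. antipode A a1 \<stileturn> a2)"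
    by (rule bilinear_map_precompose[OF rprod_bilinear antipode_linear linear_map_id[OF module_axioms]])
  then show ?thesis
    using antipode_left[OF grouplikesD(1)[OF g]] grouplikesD[OF g] grouplikesD(1)[OF bar_unit_grouplike]
      sweedler_grouplike[OF module_axioms module_axioms _ g] by simp
qed

lemma sweedler_conjugation_grouplike:
  assumes g: "g \<in> grouplikes K A" and h: "h \<in> carrier A"
  shows "sweedler A K A g (\<lambda>g1 g2. (g1 \<turnstile> h) \<stileturn> antipode A g2) = (g \<turnstile> h) \<stileturn> antipode A g"
  by (rule sweedler_grouplike[OF module_axioms module_axioms
        bilinear_map_precompose[OF rprod_bilinear bilinear_mapD(2)[OF lprod_bilinear h] antipode_linear] g])

end

section \<open>The digroup of group-like elements\<close>

lemma Glike_sel [simp]: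
  "carrier (Glike K A) = grouplikes K A"
  "dleft (Glike K A) = lprod A"
  "dright (Glike K A) = rprod A"
  "dunit (Glike K A) = \<xi>\<^bsub>A\<^esub>"
  by (simp_all add: Glike_def)

lemma antipode_is_digroup_inverse:
  assumes "cocommutative_hopf_dialgebra K A" "g \<in> grouplikes K A"
  shows "is_digroup_inverse (Glike K A) g (antipode A g)"
proof -
  interpret cocommutative_hopf_dialgebra K A by fact
  show ?thesis
    using assms(2) antipode_grouplike antipode_right_grouplike antipode_left_grouplike
    by (simp add: is_digroup_inverse_def)
qed

lemma is_digroup_Glike:
  fixes A :: "('k, 'a) hopf_dialgebra"
  assumes "cocommutative_hopf_dialgebra K A"
  shows "is_digroup (Glike K A)"
proof -
  interpret cocommutative_hopf_dialgebra K A by fact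
  note carrier = grouplikesD(1)[of _ K A]
  note closed = lprod_grouplike rprod_grouplike antipode_grouplike
  have xi: "\<xi>\<^bsub>A\<^esub> \<in> Halo (Glike K A)"
    using bar_unit_grouplike carrier by (simp add: Halo_def bar_unit_left bar_unit_right)
  have "generalized_digroup (Glike K A)"
  proof
    fix e x assume e: "e \<in> Halo (Glike K A)" and "x \<in> carrier (Glike K A)"
    then have x: "x \<in> grouplikes K A" and eg: "e \<in> grouplikes K A"
      using HaloD(1)[OF e] by simp_all
    have Sx: "antipode A x \<in> grouplikes K A" using x by (rule antipode_grouplike)
    \<comment> \<open>The antipode inverts \<open>x\<close> relative to \<xi>. For another bar-unit
      \<open>e\<close>, translate by \<open>e\<close>: S(x) \<turnstile> e is a right inverse and e
      \<stileturn> S(x) a left one.\<close>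
    have "x \<turnstile>\<^bsub>A\<^esub> (antipode A x \<turnstile>\<^bsub>A\<^esub> e) = e"
      using x eg Sx carrier
      by (simp add: lprod_assoc[symmetric] antipode_right_grouplike bar_unit_left)
    then show "\<exists>y \<in> carrier (Glike K A). x \<turnstile>\<^sub>D\<^bsub>Glike K A\<^esub> y = e"
      using closed(1)[OF Sx eg] by auto
    have "(e \<stileturn>\<^bsub>A\<^esub> antipode A x) \<stileturn>\<^bsub>A\<^esub> x = e"
      using x eg Sx carrier
      by (simp add: rprod_assoc antipode_left_grouplike bar_unit_right)
    then show "\<exists>y \<in> carrier (Glike K A). y \<stileturn>\<^sub>D\<^bsub>Glike K A\<^esub> x = e"
      using closed(2)[OF eg Sx] by auto
  qed (use xi bar_unit_grouplike closed carrier in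
      \<open>auto simp: lprod_assoc rprod_assoc inner_assoc bar_left[symmetric] bar_right\<close>)
  then show ?thesis
  proof (rule is_digroup.intro, unfold_locales)
    show "dunit (Glike K A) \<in> Halo (Glike K A)" using xi by simp
    fix x assume "x \<in> carrier (Glike K A)"
    then have x: "x \<in> grouplikes K A" by simp
    \<comment> \<open>Solving \<open>y \<stileturn> x = \<xi>\<close> for \<open>y\<close> gives a
      formula without \<open>y\<close>, so any two inverses coincide; S(x) satisfies the same
      equation and provides existence.\<close>
    have "y = \<xi>\<^bsub>A\<^esub> \<stileturn>\<^bsub>A\<^esub> antipode A x" if y: "is_digroup_inverse (Glike K A) x y" for y
    proof -
      let ?S = "antipode A x"
      have c: "x \<in> carrier A" "y \<in> carrier A" "?S \<in> carrier A"
        and yx: "y \<stileturn>\<^bsub>A\<^esub> x = \<xi>\<^bsub>A\<^esub>"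
        using x y carrier antipode_closed by (auto simp: is_digroup_inverse_def)
      have "y = y \<stileturn>\<^bsub>A\<^esub> (x \<turnstile>\<^bsub>A\<^esub> ?S)"
        using c by (simp add: antipode_right_grouplike[OF x] bar_unit_right)
      also have "\<dots> = (y \<stileturn>\<^bsub>A\<^esub> x) \<stileturn>\<^bsub>A\<^esub> ?S"
        using c by (simp add: bar_right[symmetric] rprod_assoc)
      finally show ?thesis by (simp add: yx)
    qed
    then show "\<exists>!y. is_digroup_inverse (Glike K A) x y"
      using antipode_is_digroup_inverse[OF assms x] by blast
  qed
qed

lemmas generalized_digroup_Glike = is_digroup.axioms(1)[OF is_digroup_Glike]

section \<open>The category of Hopf dialgebras and the functor to digroups\<close>

lemma hopf_dialgebra_morphismD:
  assumes "hopf_dialgebra_morphism K A B f"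
  shows "coalgebra_morphism K A B f" "linear_map K A B f" "f \<xi>\<^bsub>A\<^esub> = \<xi>\<^bsub>B\<^esub>"
    and "a \<in> carrier A \<Longrightarrow> b \<in> carrier A \<Longrightarrow> f (a \<turnstile>\<^bsub>A\<^esub> b) = f a \<turnstile>\<^bsub>B\<^esub> f b"
    and "a \<in> carrier A \<Longrightarrow> b \<in> carrier A \<Longrightarrow> f (a \<stileturn>\<^bsub>A\<^esub> b) = f a \<stileturn>\<^bsub>B\<^esub> f b"
    and "a \<in> carrier A \<Longrightarrow> f (antipode A a) = antipode B (f a)"
  using assms by (auto simp: hopf_dialgebra_morphism_def coalgebra_morphism_def)

lemma hopf_dialgebra_morphism_restrict:
  assumes A: "cocommutative_hopf_dialgebra K A" and B: "cocommutative_hopf_dialgebra K B"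
    and f: "hopf_dialgebra_morphism K A B f"
  shows "hopf_dialgebra_morphism K A B (restrict f (carrier A))"
proof -
  interpret A: cocommutative_hopf_dialgebra K A by (rule A)
  interpret B: cocommutative_hopf_dialgebra K B by (rule B)
  note D = hopf_dialgebra_morphismD[OF f]
  have "coalgebra_morphism K A B (restrict f (carrier A))"
    by (rule coalgebra_morphism_cong[OF A.cocommutative_coalgebra_axioms B.module_axioms D(1)]) simp
  then show ?thesis
    using D grouplikesD(1)[OF A.bar_unit_grouplike] A.lprod_closed A.rprod_closed A.antipode_closed
    by (simp add: hopf_dialgebra_morphism_def)
qed

lemma category_HopfDialg: "category (HopfDialg K :: (('k, 'a) hopf_dialgebra, 'a \<Rightarrow> 'a) cat)"
  unfolding HopfDialg_def
proof (rule category_concrete_cat)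
  fix A :: "('k, 'a) hopf_dialgebra" assume "A \<in> {A. cocommutative_hopf_dialgebra K A}"
  then have A: "cocommutative_hopf_dialgebra K A" by simp
  have "hopf_dialgebra_morphism K A A (\<lambda>x. x)"
    using coalgebra_morphism_id[OF cocommutative_hopf_dialgebra.axioms(1)[OF A]]
    by (simp add: hopf_dialgebra_morphism_def)
  then show "hopf_dialgebra_morphism K A A (\<lambda>x \<in> carrier A. x)"
    by (rule hopf_dialgebra_morphism_restrict[OF A A])
next
  fix A B C :: "('k, 'a) hopf_dialgebra" and f g
  assume "A \<in> {A. cocommutative_hopf_dialgebra K A}" "B \<in> {A. cocommutative_hopf_dialgebra K A}"
    "C \<in> {A. cocommutative_hopf_dialgebra K A}"
    and f: "hopf_dialgebra_morphism K A B f" and g: "hopf_dialgebra_morphism K B C g"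
  then have A: "cocommutative_hopf_dialgebra K A" and B: "cocommutative_hopf_dialgebra K B"
    and C: "cocommutative_hopf_dialgebra K C" by simp_all
  note co = cocommutative_hopf_dialgebra.axioms(1)
  note Df = hopf_dialgebra_morphismD[OF f] and Dg = hopf_dialgebra_morphismD[OF g]
  have "hopf_dialgebra_morphism K A C (\<lambda>x. g (f x))"
    using coalgebra_morphism_compose[OF A[THEN co] B[THEN co] C[THEN co] Df(1) Dg(1)]
      linear_mapD(1)[OF Df(2)] Df Dg
    by (simp add: hopf_dialgebra_morphism_def)
  then show "hopf_dialgebra_morphism K A C (compose (carrier A) g f)"
    unfolding compose_def by (rule hopf_dialgebra_morphism_restrict[OF A C])
qed

lemma hopf_dialgebra_morphism_grouplikes:
  assumes A: "cocommutative_hopf_dialgebra K A" and B: "cocommutative_hopf_dialgebra K B"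
    and f: "hopf_dialgebra_morphism K A B f"
  shows "f \<in> grouplikes K A \<rightarrow> grouplikes K B"
proof -
  interpret A: cocommutative_hopf_dialgebra K A by (rule A)
  interpret B: cocommutative_hopf_dialgebra K B by (rule B)
  show ?thesis
    using coalgebra_morphism_grouplike[OF A.module_axioms B.module_axioms
        hopf_dialgebra_morphismD(1)[OF f]] by blast
qed

text \<open>
  A bar-unit \<open>e\<close> of \<open>Glike A\<close> need not be \<open>\<xi>\<close>, but \<open>e \<turnstile> \<xi> = \<xi>\<close> and \<open>\<xi> \<stileturn> e = \<xi>\<close>; these equations are
  preserved by \<open>f\<close>, and they characterize bar-units.
\<close>

lemma gDig_morphism_Glike:
  fixes A B :: "('k, 'a) hopf_dialgebra"
  assumes A: "cocommutative_hopf_dialgebra K A" and B: "cocommutative_hopf_dialgebra K B"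
    and f: "hopf_dialgebra_morphism K A B f"
  shows "gDig_morphism (Glike K A) (Glike K B) f"
proof -
  interpret A: cocommutative_hopf_dialgebra K A by (rule A)
  interpret B: cocommutative_hopf_dialgebra K B by (rule B)
  note D = hopf_dialgebra_morphismD[OF f]
  note xi = A.bar_unit_grouplike grouplikesD(1)[OF A.bar_unit_grouplike]
    grouplikesD(1)[OF B.bar_unit_grouplike]
  have "f e \<in> Halo (Glike K B)" if e: "e \<in> Halo (Glike K A)" for e
  proof -
    have eg: "e \<in> grouplikes K A" using HaloD(1)[OF e] by simp
    have ec: "e \<in> carrier A" by (rule grouplikesD(1)[OF eg])
    have fe: "f e \<in> grouplikes K B"
      using hopf_dialgebra_morphism_grouplikes[OF assms] eg by blast
    have fec: "f e \<in> carrier B" by (rule grouplikesD(1)[OF fe])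
    have "f e \<turnstile>\<^bsub>B\<^esub> \<xi>\<^bsub>B\<^esub> = f (e \<turnstile>\<^bsub>A\<^esub> \<xi>\<^bsub>A\<^esub>)" using ec xi D by simp
    then have l: "f e \<turnstile>\<^bsub>B\<^esub> \<xi>\<^bsub>B\<^esub> = \<xi>\<^bsub>B\<^esub>" using HaloD(3)[OF e] xi D by simp
    have "\<xi>\<^bsub>B\<^esub> \<stileturn>\<^bsub>B\<^esub> f e = f (\<xi>\<^bsub>A\<^esub> \<stileturn>\<^bsub>A\<^esub> e)" using ec xi D by simp
    then have r: "\<xi>\<^bsub>B\<^esub> \<stileturn>\<^bsub>B\<^esub> f e = \<xi>\<^bsub>B\<^esub>" using HaloD(2)[OF e] xi D by simp
    \<comment> \<open>Write \<open>w\<close> as \<xi> \<turnstile> w or as w \<stileturn> \<xi> and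
      reassociate: \<open>f e\<close> then stands next to \<xi>, which absorbs it by
      \<open>l\<close> or \<open>r\<close>.\<close>
    have "f e \<turnstile>\<^bsub>B\<^esub> w = w" "w \<stileturn>\<^bsub>B\<^esub> f e = w" if w: "w \<in> carrier B" for w
      using B.lprod_assoc[OF fec xi(3) w] B.rprod_assoc[OF w xi(3) fec] l r w
      by (simp_all add: B.bar_unit_left B.bar_unit_right)
    then show ?thesis using fe grouplikesD(1)[of _ K B] by (simp add: Halo_def)
  qed
  then show ?thesis
    using D grouplikesD(1)[of _ K A] by (simp add: gDig_morphism_def)
qed

lemma is_functor_Glike:
  "is_functor (HopfDialg K :: (('k, 'a) hopf_dialgebra, 'a \<Rightarrow> 'a) cat) Dig (Glike_functor K)"
  using category_HopfDialg category_Dig unfolding HopfDialg_def Dig_def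
proof (rule is_functor_restrict)
  fix A B :: "('k, 'a) hopf_dialgebra" and f
  assume "A \<in> {A. cocommutative_hopf_dialgebra K A}" "B \<in> {A. cocommutative_hopf_dialgebra K A}"
    and f: "hopf_dialgebra_morphism K A B f"
  then have A: "cocommutative_hopf_dialgebra K A" and B: "cocommutative_hopf_dialgebra K B"
    by simp_all
  show "f \<in> carrier (on_obj (Glike_functor K) A) \<rightarrow> carrier (on_obj (Glike_functor K) B)"
    using hopf_dialgebra_morphism_grouplikes[OF A B f] by (simp add: Glike_functor_def)
  let ?f = "restrict f (carrier (on_obj (Glike_functor K) A))"
  show "gDig_morphism (on_obj (Glike_functor K) A) (on_obj (Glike_functor K) B) ?f
      \<and> ?f (dunit (on_obj (Glike_functor K) A)) = dunit (on_obj (Glike_functor K) B)"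
    using gDig_morphism_restrict[OF generalized_digroup_Glike[OF A], of "Glike K B" f]
      gDig_morphism_Glike[OF A B f] hopf_dialgebra_morphismD(3)[OF f]
      cocommutative_hopf_dialgebra.bar_unit_grouplike[OF A]
    by (simp add: Glike_functor_def)
qed (auto simp: Glike_functor_def is_digroup_Glike dest: grouplikesD(1))

text \<open>\<open>Adj K A\<close> and \<open>A\<close> are records of different types, so their
  tensor squares are built separately; down at the relations only the shared module structure
  enters.\<close>

lemma grouplikes_Adj [simp]: "grouplikes K (Adj K A) = grouplikes K A"
  by (simp add: grouplikes_def tensor_def tensor_kernel_def tensor_relations_def Adj_def)

lemma Slike_Adj_sel [simp]:
  "carrier (Slike K (Adj K A)) = grouplikes K A"
  "rack_op (Slike K (Adj K A)) g h
    = sweedler A K A g (\<lambda>g1 g2. (g1 \<turnstile>\<^bsub>A\<^esub> h) \<stileturn>\<^bsub>A\<^esub> antipode A g2)"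
  unfolding Slike_def by simp (simp add: Adj_def)

text \<open>Since \<xi> is a bar-unit, S(g) is an admissible one-sided inverse and may replace the
  arbitrary choice in \<open>Conj\<close>.\<close>

lemma Conj_Glike_op:
  assumes A: "cocommutative_hopf_dialgebra K A"
    and g: "g \<in> grouplikes K A" and h: "h \<in> grouplikes K A"
  shows "g \<triangleright>\<^bsub>Conj (on_obj Dig_inclusion (Glike K A))\<^esub> h = (g \<turnstile>\<^bsub>A\<^esub> h) \<stileturn>\<^bsub>A\<^esub> antipode A g"
proof -
  let ?D = "gdigroup.truncate (Glike K A)"
  have "one_sided_inverse ?D g (antipode A g)"
    using antipode_is_digroup_inverse[OF A g] is_digroup.dunit_bar_unit[OF is_digroup_Glike[OF A]]
    by (simp add: one_sided_inverse_truncate one_sided_inverse_def is_digroup_inverse_def)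
  then have "g \<triangleright>\<^bsub>Conj ?D\<^esub> h = (g \<turnstile>\<^sub>D\<^bsub>?D\<^esub> h) \<stileturn>\<^sub>D\<^bsub>?D\<^esub> antipode A g"
    using generalized_digroup_Glike[OF A] g h
    by (intro Conj_op_eq) (simp_all add: generalized_digroup_truncate)
  then show ?thesis by (simp add: Dig_inclusion_def)
qed

lemma Slike_Adj_op:
  assumes A: "cocommutative_hopf_dialgebra K A"
    and g: "g \<in> grouplikes K A" and h: "h \<in> grouplikes K A"
  shows "g \<triangleright>\<^bsub>Slike K (Adj K A)\<^esub> h = g \<triangleright>\<^bsub>Conj (on_obj Dig_inclusion (Glike K A))\<^esub> h"
  using cocommutative_hopf_dialgebra.sweedler_conjugation_grouplike[OF A g grouplikesD(1)[OF h]]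
    Conj_Glike_op[OF A g h] by simp

text \<open>The adjoint product and conjugation may differ off the group-likes, so the racks need
  not be equal as records; the axioms are transported along agreement on the carrier.\<close>

lemma is_rack_cong:
  assumes "is_rack X" "carrier Y = carrier X"
    and op: "\<And>x y. x \<in> carrier X \<Longrightarrow> y \<in> carrier X \<Longrightarrow> x \<triangleright>\<^bsub>Y\<^esub> y = x \<triangleright>\<^bsub>X\<^esub> y"
  shows "is_rack Y"
proof -
  interpret is_rack X by fact
  have closed: "x \<triangleright>\<^bsub>X\<^esub> y \<in> carrier X" if "x \<in> carrier X" "y \<in> carrier X" for x y
    using left_translation_bij[OF that(1)] that(2) by (auto simp: bij_betw_def)
  show ?thesis
  proof
    fix x assume "x \<in> carrier Y"
    then show "bij_betw (\<lambda>y. x \<triangleright>\<^bsub>Y\<^esub> y) (carrier Y) (carrier Y)"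
      using left_translation_bij[of x] assms(2)
        bij_betw_cong[of "carrier X" "\<lambda>y. x \<triangleright>\<^bsub>Y\<^esub> y" "\<lambda>y. x \<triangleright>\<^bsub>X\<^esub> y"] op by simp
  next
    fix x y z assume "x \<in> carrier Y" "y \<in> carrier Y" "z \<in> carrier Y"
    then show "x \<triangleright>\<^bsub>Y\<^esub> (y \<triangleright>\<^bsub>Y\<^esub> z) = (x \<triangleright>\<^bsub>Y\<^esub> y) \<triangleright>\<^bsub>Y\<^esub> (x \<triangleright>\<^bsub>Y\<^esub> z)"
      using self_distributive[of x y z] closed op assms(2) by simp
  qed (use rack_nonempty assms(2) in simp)
qed

lemma is_rack_Slike_Adj:
  fixes A :: "('k, 'a) hopf_dialgebra"
  assumes A: "cocommutative_hopf_dialgebra K A"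
  shows "is_rack (Slike K (Adj K A))"
proof (rule is_rack_cong)
  show "is_rack (Conj (on_obj Dig_inclusion (Glike K A)))"
    using generalized_digroup_Glike[OF A]
    by (intro is_rack_Conj) (simp add: Dig_inclusion_def generalized_digroup_truncate)
qed (use Slike_Adj_op[OF A] in \<open>simp_all add: Dig_inclusion_def\<close>)

lemma is_functor_SlikeAdj:
  "is_functor (HopfDialg K :: (('k, 'a) hopf_dialgebra, 'a \<Rightarrow> 'a) cat) Rack (SlikeAdj_functor K)"
  using category_HopfDialg category_Rack unfolding HopfDialg_def Rack_def
proof (rule is_functor_restrict)
  fix A B :: "('k, 'a) hopf_dialgebra" and f
  assume "A \<in> {A. cocommutative_hopf_dialgebra K A}" "B \<in> {A. cocommutative_hopf_dialgebra K A}"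
    and f: "hopf_dialgebra_morphism K A B f"
  then have A: "cocommutative_hopf_dialgebra K A" and B: "cocommutative_hopf_dialgebra K B"
    by simp_all
  interpret A: cocommutative_hopf_dialgebra K A by (rule A)
  interpret B: cocommutative_hopf_dialgebra K B by (rule B)
  let ?f = "restrict f (carrier (on_obj (SlikeAdj_functor K) A))"
  have grp: "f \<in> grouplikes K A \<rightarrow> grouplikes K B"
    by (rule hopf_dialgebra_morphism_grouplikes[OF A B f])
  then show "f \<in> carrier (on_obj (SlikeAdj_functor K) A) \<rightarrow> carrier (on_obj (SlikeAdj_functor K) B)"
    by (simp add: SlikeAdj_functor_def)
  note conj = A.sweedler_conjugation_grouplike B.sweedler_conjugation_grouplike
  show "\<forall>x \<in> carrier (on_obj (SlikeAdj_functor K) A). \<forall>y \<in> carrier (on_obj (SlikeAdj_functor K) A).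
      ?f (x \<triangleright>\<^bsub>on_obj (SlikeAdj_functor K) A\<^esub> y) = ?f x \<triangleright>\<^bsub>on_obj (SlikeAdj_functor K) B\<^esub> ?f y"
    using grp hopf_dialgebra_morphismD[OF f]
    by (simp add: SlikeAdj_functor_def conj Pi_iff grouplikesD(1)[of _ K A] grouplikesD(1)[of _ K B] A.lprod_closed A.antipode_closed
        A.lprod_grouplike A.rprod_grouplike A.antipode_grouplike)
qed (auto simp: SlikeAdj_functor_def is_rack_Slike_Adj dest: grouplikesD(1))

section \<open>The natural isomorphism and the explicit product formula\<close>

theorem theorem5p5:
  fixes K :: "('k, 'r) ring_scheme"
  assumes "field K" and "char_zero K"
  shows "is_functor (HopfDialg K :: (('k, 'a) hopf_dialgebra, 'a \<Rightarrow> 'a) cat) Rack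
           (SlikeAdj_functor K)
       \<and> is_functor (HopfDialg K :: (('k, 'a) hopf_dialgebra, 'a \<Rightarrow> 'a) cat) Dig (Glike_functor K)
       \<and> is_functor (Dig :: ('a digroup, 'a \<Rightarrow> 'a) cat) gDig Dig_inclusion
       \<and> is_functor (gDig :: ('a gdigroup, 'a \<Rightarrow> 'a) cat) Rack Conj_functor
       \<and> naturally_isomorphic (HopfDialg K :: (('k, 'a) hopf_dialgebra, 'a \<Rightarrow> 'a) cat) Rack
           (SlikeAdj_functor K) (Conj_functor \<circ>\<^sub>F Dig_inclusion \<circ>\<^sub>F Glike_functor K)
       \<and> (\<forall>A :: ('k, 'a) hopf_dialgebra. cocommutative_hopf_dialgebra K A \<longrightarrow>
           (\<forall>g \<in> carrier (Glike K A). is_digroup_inverse (Glike K A) g (antipode A g) \<and>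
             (\<forall>h \<in> carrier (Glike K A).
               g \<triangleright>\<^bsub>Slike K (Adj K A)\<^esub> h
                 = sweedler A K A g (\<lambda>g1 g2. (g1 \<turnstile>\<^bsub>A\<^esub> h) \<stileturn>\<^bsub>A\<^esub> antipode A g2)
             \<and> sweedler A K A g (\<lambda>g1 g2. (g1 \<turnstile>\<^bsub>A\<^esub> h) \<stileturn>\<^bsub>A\<^esub> antipode A g2)
                 = (g \<turnstile>\<^bsub>A\<^esub> h) \<stileturn>\<^bsub>A\<^esub> antipode A g
             \<and> (g \<turnstile>\<^bsub>A\<^esub> h) \<stileturn>\<^bsub>A\<^esub> antipode A g
                 = g \<triangleright>\<^bsub>Conj (on_obj Dig_inclusion (Glike K A))\<^esub> h)))"
proof (intro conjI allI impI ballI)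
  let ?H = "HopfDialg K :: (('k, 'a) hopf_dialgebra, 'a \<Rightarrow> 'a) cat"
  let ?G = "Conj_functor \<circ>\<^sub>F Dig_inclusion \<circ>\<^sub>F Glike_functor K
    :: (('k, 'a) hopf_dialgebra, 'a \<Rightarrow> 'a, 'a rack, 'a \<Rightarrow> 'a) ftor"
  show S: "is_functor ?H Rack (SlikeAdj_functor K)" by (rule is_functor_SlikeAdj)
  show G: "is_functor ?H Dig (Glike_functor K)" by (rule is_functor_Glike)
  show I: "is_functor (Dig :: ('a digroup, 'a \<Rightarrow> 'a) cat) gDig Dig_inclusion"
    by (rule is_functor_Dig_inclusion)
  show C: "is_functor (gDig :: ('a gdigroup, 'a \<Rightarrow> 'a) cat) Rack Conj_functor"
    by (rule is_functor_Conj)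
  have comp: "is_functor ?H Rack ?G"
    by (rule is_functor_comp[OF is_functor_comp[OF G I] C])
  have "natural_isomorphism ?H Rack (SlikeAdj_functor K) ?G (\<lambda>A. \<lambda>x \<in> grouplikes K A. x)"
  proof (intro natural_isomorphism.intro natural_isomorphism_axioms.intro S comp)
    fix A :: "('k, 'a) hopf_dialgebra" assume "A \<in> Obj ?H"
    then have A: "cocommutative_hopf_dialgebra K A" by (simp add: HopfDialg_def)
    let ?R = "Slike K (Adj K A)" and ?C = "Conj (on_obj Dig_inclusion (Glike K A))"
    let ?id = "\<lambda>x \<in> grouplikes K A. x"
    have carrier: "carrier ?C = grouplikes K A" by (simp add: Dig_inclusion_def)
    have closed: "g \<triangleright>\<^bsub>?R\<^esub> h \<in> grouplikes K A"
      if "g \<in> grouplikes K A" "h \<in> grouplikes K A" for g h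
      using is_rack.left_translation_bij[OF is_rack_Slike_Adj[OF A], of g] that
      by (auto simp: bij_betw_def simp del: Slike_Adj_sel(2))
    \<comment> \<open>Carriers coincide and the operations agree on them, so the identity is a
      homomorphism in both directions and its own inverse.\<close>
    have hom: "?id \<in> Hom Rack ?R ?C" "?id \<in> Hom Rack ?C ?R"
      using Slike_Adj_op[OF A, symmetric] closed
      by (simp_all add: Rack_def carrier del: Slike_Adj_sel(2) Conj_sel)
    have "is_isomorphism Rack ?R ?C ?id"
      unfolding is_isomorphism_def
    proof (intro conjI bexI)
      show "Comp Rack ?R ?C ?R ?id ?id = Ident Rack ?R"
        "Comp Rack ?C ?R ?C ?id ?id = Ident Rack ?C"
        by (simp_all add: Rack_def carrier compose_def fun_eq_iff del: Conj_sel(1))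
    qed (rule hom)+
    then show "is_isomorphism Rack (on_obj (SlikeAdj_functor K) A) (on_obj ?G A) ?id"
      by (simp add: SlikeAdj_functor_def ftor_comp_def Conj_functor_def Glike_functor_def)
  next
    fix A B :: "('k, 'a) hopf_dialgebra" and f
    assume "A \<in> Obj ?H" "B \<in> Obj ?H" "f \<in> Hom ?H A B"
    then have "f \<in> grouplikes K A \<rightarrow> grouplikes K B"
      using hopf_dialgebra_morphism_grouplikes[of K A B f] by (simp add: HopfDialg_def)
    \<comment> \<open>Both composites are the restriction of \<open>f\<close> to group-likes; that
      \<open>f\<close> maps group-likes to group-likes is what lets the identity at \<open>B\<close>
      leave its values unchanged.\<close>
    then show "Comp Rack (on_obj (SlikeAdj_functor K) A) (on_obj ?G A) (on_obj ?G B)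
          (on_hom ?G A B f) (\<lambda>x \<in> grouplikes K A. x)
        = Comp Rack (on_obj (SlikeAdj_functor K) A) (on_obj (SlikeAdj_functor K) B) (on_obj ?G B)
          (\<lambda>x \<in> grouplikes K B. x) (on_hom (SlikeAdj_functor K) A B f)"
      by (auto simp: Rack_def SlikeAdj_functor_def ftor_comp_def Conj_functor_def
          Dig_inclusion_def Glike_functor_def compose_def fun_eq_iff Pi_iff)
  qed
  then show "naturally_isomorphic ?H Rack (SlikeAdj_functor K) ?G"
    unfolding naturally_isomorphic_def by blast
next
  fix A :: "('k, 'a) hopf_dialgebra" and g h
  assume A: "cocommutative_hopf_dialgebra K A" and "g \<in> carrier (Glike K A)"
  then have g: "g \<in> grouplikes K A" by simp
  show "is_digroup_inverse (Glike K A) g (antipode A g)"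
    by (rule antipode_is_digroup_inverse[OF A g])
  assume "h \<in> carrier (Glike K A)"
  then have h: "h \<in> grouplikes K A" by simp
  show "g \<triangleright>\<^bsub>Slike K (Adj K A)\<^esub> h
      = sweedler A K A g (\<lambda>g1 g2. (g1 \<turnstile>\<^bsub>A\<^esub> h) \<stileturn>\<^bsub>A\<^esub> antipode A g2)"
    by simp
  show "sweedler A K A g (\<lambda>g1 g2. (g1 \<turnstile>\<^bsub>A\<^esub> h) \<stileturn>\<^bsub>A\<^esub> antipode A g2)
      = (g \<turnstile>\<^bsub>A\<^esub> h) \<stileturn>\<^bsub>A\<^esub> antipode A g"
    by (rule cocommutative_hopf_dialgebra.sweedler_conjugation_grouplike[OF A g grouplikesD(1)[OF h]])
  show "(g \<turnstile>\<^bsub>A\<^esub> h) \<stileturn>\<^bsub>A\<^esub> antipode A g = g \<triangleright>\<^bsub>Conj (on_obj Dig_inclusion (Glike K A))\<^esub> h"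
    by (rule Conj_Glike_op[OF A g h, symmetric])
qed

end
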